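(* Let $(X_i)_{i\ge1}$ be i.i.d. random variables on $(\Omega,\mathcal A,\mathbb P)$ with values in $\mathbb N^*=\{1,2,\dots\}$, and let $S_0=0$, $S_n=\sum_{i=1}^nX_i$ for $n\ge 1$. Let $(\xi_i)_{i\in\mathbb N}$ be a strictly stationary sequence of square integrable real random variables on a probability space $(E,\mathcal E,\mu)$, with mean $m=\mathbb E_\mu(\xi_0)$. Assume that there is a function $g:(0,\infty)\to[0,\infty)$ such that $\theta_2^{\xi}(n)\le g(n)$ for all integers $n\ge1$, the map $x\mapsto x^{3/2}g(x)$ is non-increasing, and there exists $\varepsilon\in(0,1)$ with $\sum_{i=0}^\infty2^{3i/2}g(2^{i\varepsilon})<\infty$. For $n\ge1$ let $$\hat m_n=\frac1n\sum_{i=1}^n\xi_{S_i},\qquad a(S)=\lim_{n\to+\infty}\bigl(n\operatorname{Var}\hat m_n\bigr),$$ where the variance is taken under $\mathbb P\otimes\mu$, and assume that $a(S)$ is finite and positive. Then, for $\mathbb P$-almost every $\omega\in\Omega$, the random variables $\sqrt n\,(\hat m_n(\omega,\cdot)-m)$ on $(E,\mathcal E,\mu)$ converge in distribution, as $n\to+\infty$, to $\mathcal N(0,a(S))$.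
   Context: The walk and the process are defined on the product space $(\Omega\times E,\mathbb P\otimes\mu)$, so $\hat m_n(\omega,y)=\frac1n\sum_{i=1}^n\xi_{S_i(\omega)}(y)$. The dependence coefficient $\theta_2^\xi(n)$ is defined as follows. On $\mathbb R^r$ let $d_1(x,y)=\sum_{i=1}^r|x_i-y_i|$. Let $\tilde\Lambda$ be the set of all functions $f:\mathbb R^r\to\mathbb R$ (for some $r\ge1$) that are Lipschitz with respect to $d_1$ with Lipschitz constant at most $1$. For a square integrable $\mathbb R^r$-valued random variable $Y$ and a $\sigma$-algebra $\mathcal M$, set $$\theta_2(\mathcal M,Y)=\sup\{\|\mathbb E(f(Y)\mid\mathcal M)-\mathbb E(f(Y))\|_2:\ f\in\tilde\Lambda,\ f \text{ defined on } \mathbb R^r\}.$$ With $\mathcal M_i=\sigma(\xi_j,\ 0\le j\le i)$, $i\in\mathbb N$, set $$\theta_2^\xi(n)=\sup_{l\in\mathbb N^*}\frac1l\sup\{\theta_2(\mathcal M_p,(\xi_{j_1},\dots,\xi_{j_l})):\ p\in\mathbb N,\ p+n\le j_1<\dots<j_l\}.$$ *)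

theory Defs
  imports "HOL-Probability.Probability"
begin

text \<open>
  A vector of dimension \<open>r\<close> is a function in \<open>{..<r} \<rightarrow>\<^sub>E UNIV\<close> (coordinates numbered from 0), so that
  the dimension can be quantified over; this is the carrier of the product space
  \<open>\<Pi>\<^sub>M i\<in>{..<r}. borel\<close>.
\<close>

definition d1 :: "nat \<Rightarrow> (nat \<Rightarrow> real) \<Rightarrow> (nat \<Rightarrow> real) \<Rightarrow> real" where
  "d1 r x y = (\<Sum>i<r. \<bar>x i - y i\<bar>)"

definition Lip1 :: "nat \<Rightarrow> ((nat \<Rightarrow> real) \<Rightarrow> real) set" where
  "Lip1 r = {f. \<forall>x \<in> {..<r} \<rightarrow>\<^sub>E UNIV. \<forall>y \<in> {..<r} \<rightarrow>\<^sub>E UNIV. \<bar>f x - f y\<bar> \<le> d1 r x y}"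

text \<open>
  Only meant for square integrable functions: for other arguments the Bochner integral is 0 by
  convention.
\<close>

definition L2_norm :: "'a measure \<Rightarrow> ('a \<Rightarrow> real) \<Rightarrow> real" where
  "L2_norm M h = sqrt (\<integral>x. (h x)\<^sup>2 \<partial>M)"

text \<open>
  \<open>theta2 M F r Y\<close> is the coefficient of the sub-\<open>\<sigma>\<close>-algebra \<open>F\<close> of \<open>M\<close> (of which only the sets
  matter) and the square integrable random vector \<open>Y\<close> of dimension \<open>r\<close>. The suprema are taken in
  \<open>ennreal\<close>, so no boundedness has to be known in advance.
\<close>

definition theta2 :: "'a measure \<Rightarrow> 'a measure \<Rightarrow> nat \<Rightarrow> ('a \<Rightarrow> nat \<Rightarrow> real) \<Rightarrow> ennreal" where
  "theta2 M F r Y =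
     (SUP f \<in> Lip1 r. ennreal (L2_norm M
        (\<lambda>x. real_cond_exp M F (\<lambda>z. f (Y z)) x - (\<integral>z. f (Y z) \<partial>M))))"

definition past_algebra :: "'a measure \<Rightarrow> (nat \<Rightarrow> 'a \<Rightarrow> real) \<Rightarrow> nat \<Rightarrow> 'a measure" where
  "past_algebra M \<xi> p =
     sigma (space M) (\<Union>j\<in>{..p}. {\<xi> j -` A \<inter> space M | A. A \<in> sets borel})"

text \<open>
  The indices \<open>j\<^sub>1 < \<dots> < j\<^sub>l\<close> are the values of \<open>j\<close> on \<open>{..<l}\<close>.
\<close>

definition theta2_seq :: "'a measure \<Rightarrow> (nat \<Rightarrow> 'a \<Rightarrow> real) \<Rightarrow> nat \<Rightarrow> ennreal" where
  "theta2_seq M \<xi> n =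
     (SUP l \<in> {1..}.
        (SUP (p, j) \<in> {(p, j). strict_mono_on {..<l} j \<and> p + n \<le> j 0}.
           theta2 M (past_algebra M \<xi> p) l (\<lambda>x. \<lambda>i\<in>{..<l}. \<xi> (j i) x))
        / of_nat l)"

definition strictly_stationary :: "'a measure \<Rightarrow> (nat \<Rightarrow> 'a \<Rightarrow> real) \<Rightarrow> bool" where
  "strictly_stationary M \<xi> \<longleftrightarrow>
     (\<forall>i. \<xi> i \<in> borel_measurable M) \<and>
     (\<forall>J h. finite J \<longrightarrow>
        distr M (\<Pi>\<^sub>M i\<in>J. borel) (\<lambda>x. \<lambda>i\<in>J. \<xi> (i + h) x) =
        distr M (\<Pi>\<^sub>M i\<in>J. borel) (\<lambda>x. \<lambda>i\<in>J. \<xi> i x))"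

definition walk :: "(nat \<Rightarrow> 'a \<Rightarrow> nat) \<Rightarrow> nat \<Rightarrow> 'a \<Rightarrow> nat" where
  "walk X n \<omega> = (\<Sum>i = 1..n. X i \<omega>)"

definition m_hat :: "(nat \<Rightarrow> 'a \<Rightarrow> nat) \<Rightarrow> (nat \<Rightarrow> 'b \<Rightarrow> real) \<Rightarrow> nat \<Rightarrow> 'a \<Rightarrow> 'b \<Rightarrow> real" where
  "m_hat X \<xi> n \<omega> y = (\<Sum>i = 1..n. \<xi> (walk X i \<omega>) y) / real n"

end

theory Submission
  imports Defs "HOL-Real_Asymp.Real_Asymp"
begin

text \<open>Two facts carry the theorem: a central limit theorem for a fixed (quenched) trajectory of the
walk, whose Gaussian approximation carries the variance of that trajectory, and the almost sure
convergence of this variance, divided by \<open>n\<close>, to \<open>a\<close>.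

What is used about \<open>g\<close> is that \<open>n powr (3/2) * g n \<longlonglongrightarrow> 0\<close>: the function \<open>x powr (3/2) * g x\<close> is
non-increasing, and along \<open>x = 2 powr (i * \<epsilon>)\<close> it is at most the \<open>i\<close>-th term of the convergent
series. In particular \<open>g\<close> is summable over the positive integers, so covariances are absolutely
summable.

For a fixed trajectory: since the steps of the walk are at least 1, the sampled sequence
\<open>\<xi> (S\<^sub>1), \<xi> (S\<^sub>2), \<dots>\<close> has gaps at least as long as those of \<open>\<xi>\<close> and inherits its dependence bounds
(\<open>weakly_dependent_subsequence\<close>). It need not be stationary, but it is identically distributed, and that is
enough for Bernstein's method of blocks: blocks of \<open>p\<close> indices are separated by gaps of \<open>q\<close>
indices. Replacing the blocks one at a time by independent copies changes the characteristic
function of the normalised sum by at most \<open>4 * \<bar>t\<bar> * sqrt n * g q\<close> in total, because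
\<open>cos\<close> and \<open>sin\<close> of a block sum are Lipschitz functions of the block (\<open>cf_decoupling\<close>, \<open>cf_blocks\<close>).
With \<open>q\<close> of order \<open>n powr (1/3)\<close> this is where \<open>g n = o(n powr (-3/2))\<close> is needed. For
bounded variables and \<open>q \<lless> p \<lless> sqrt n\<close> a second order Taylor expansion of each block and the
summability of covariances finish the argument (\<open>cf_normal_limit_bounded\<close>). Square integrable
variables are truncated at a level \<open>k\<close>; truncation and its remainder are Lipschitz functions, so the
remainder obeys the same covariance bounds, with a constant that vanishes as \<open>k \<rightarrow> \<infinity>\<close>
(\<open>cf_normal_limit\<close>, \<open>clt\<close>).

As to the variance: that of \<open>\<xi> (S\<^sub>1) + \<dots> + \<xi> (S\<^sub>n)\<close> is \<open>n * \<gamma> 0\<close> plus twice the sum over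
pairs \<open>i < k\<close> of the autocovariance \<open>\<gamma>\<close> at the distance of the walk between the times \<open>i\<close> and \<open>k\<close>. For a fixed
lag \<open>k - i\<close> the terms are bounded and form a sequence with finite range of dependence, so a strong
law applies; the lags are summed by dominated convergence. Hence the quenched variance divided by
\<open>n\<close> differs from its mean by \<open>o(1)\<close>, and by Fubini's theorem that mean is \<open>n\<close> times the annealed variance of
\<open>m_hat\<close> (\<open>walk_gap_sum_concentration\<close>, \<open>integral_square_of_centred_sections\<close>).\<close>

section \<open>Square integrable random variables\<close>

context prob_space
begin

lemma L2_mult_integrable:
  fixes f g :: "'a \<Rightarrow> real"
  assumes [measurable]: "f \<in> borel_measurable M" "g \<in> borel_measurable M"
    and f: "integrable M (\<lambda>x. (f x)\<^sup>2)" and g: "integrable M (\<lambda>x. (g x)\<^sup>2)"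
  shows "integrable M (\<lambda>x. f x * g x)"
proof (rule Bochner_Integration.integrable_bound)
  show "integrable M (\<lambda>x. (f x)\<^sup>2 + (g x)\<^sup>2)" using f g by simp
  show "AE x in M. norm (f x * g x) \<le> norm ((f x)\<^sup>2 + (g x)\<^sup>2)"
  proof (rule AE_I2)
    fix x
    have "2 * (\<bar>f x\<bar> * \<bar>g x\<bar>) \<le> (f x)\<^sup>2 + (g x)\<^sup>2"
      using sum_squares_bound[of "\<bar>f x\<bar>" "\<bar>g x\<bar>"] by (simp add: mult.assoc)
    moreover have "0 \<le> \<bar>f x\<bar> * \<bar>g x\<bar>" by simp
    ultimately have "\<bar>f x\<bar> * \<bar>g x\<bar> \<le> (f x)\<^sup>2 + (g x)\<^sup>2" by linarith
    then show "norm (f x * g x) \<le> norm ((f x)\<^sup>2 + (g x)\<^sup>2)"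
      by (simp add: abs_mult)
  qed
qed simp

lemma L2_add_integrable:
  fixes f g :: "'a \<Rightarrow> real"
  assumes [measurable]: "f \<in> borel_measurable M" "g \<in> borel_measurable M"
    and f: "integrable M (\<lambda>x. (f x)\<^sup>2)" and g: "integrable M (\<lambda>x. (g x)\<^sup>2)"
  shows "integrable M (\<lambda>x. (f x + g x)\<^sup>2)"
  using L2_mult_integrable[OF assms] f g by (simp add: power2_sum mult.assoc)

lemma L2_diff_integrable:
  fixes f g :: "'a \<Rightarrow> real"
  assumes [measurable]: "f \<in> borel_measurable M" "g \<in> borel_measurable M"
    and f: "integrable M (\<lambda>x. (f x)\<^sup>2)" and g: "integrable M (\<lambda>x. (g x)\<^sup>2)"
  shows "integrable M (\<lambda>x. (f x - g x)\<^sup>2)"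
  using L2_mult_integrable[OF assms] f g by (simp add: power2_diff mult.assoc)

lemma L2_sum_integrable:
  fixes f :: "'i \<Rightarrow> 'a \<Rightarrow> real"
  assumes [measurable]: "\<And>i. f i \<in> borel_measurable M"
    and f: "\<And>i. integrable M (\<lambda>x. (f i x)\<^sup>2)"
  shows "integrable M (\<lambda>x. (\<Sum>i\<in>I. f i x)\<^sup>2)"
proof (induction I rule: infinite_finite_induct)
  case (insert i I)
  then show ?case using L2_add_integrable[of "f i" "\<lambda>x. \<Sum>i\<in>I. f i x"] f by simp
qed auto

lemma L2_norm_nonneg: "0 \<le> L2_norm M f"
  by (simp add: L2_norm_def)

lemma L2_norm_power2: "(L2_norm M f)\<^sup>2 = (\<integral>x. (f x)\<^sup>2 \<partial>M)"
  by (simp add: L2_norm_def)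

lemma L2_Cauchy_Schwarz:
  fixes f g :: "'a \<Rightarrow> real"
  assumes [measurable]: "f \<in> borel_measurable M" "g \<in> borel_measurable M"
    and f: "integrable M (\<lambda>x. (f x)\<^sup>2)" and g: "integrable M (\<lambda>x. (g x)\<^sup>2)"
  shows "\<bar>\<integral>x. f x * g x \<partial>M\<bar> \<le> L2_norm M f * L2_norm M g"
proof -
  have i: "integrable M (\<lambda>x. \<bar>f x\<bar> * \<bar>g x\<bar>)"
    using integrable_abs[OF L2_mult_integrable[OF assms]] by (simp add: abs_mult)
  have sq: "(\<integral>\<^sup>+x. (ennreal \<bar>h x\<bar>)\<^sup>2 \<partial>M) = ennreal ((L2_norm M h)\<^sup>2)"
    if "integrable M (\<lambda>x. (h x)\<^sup>2)" for h :: "'a \<Rightarrow> real"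
    using nn_integral_eq_integral[OF that] by (simp add: L2_norm_power2 ennreal_power)
  have "(ennreal (\<integral>x. \<bar>f x\<bar> * \<bar>g x\<bar> \<partial>M))\<^sup>2 = (\<integral>\<^sup>+x. ennreal \<bar>f x\<bar> * ennreal \<bar>g x\<bar> \<partial>M)\<^sup>2"
    by (subst nn_integral_eq_integral[OF i, symmetric]) (auto simp: ennreal_mult)
  also have "\<dots> \<le> ennreal ((L2_norm M f)\<^sup>2) * ennreal ((L2_norm M g)\<^sup>2)"
    using Cauchy_Schwarz_nn_integral[of "\<lambda>x. ennreal \<bar>f x\<bar>" M "\<lambda>x. ennreal \<bar>g x\<bar>"]
    by (simp add: sq f g)
  finally have "(\<integral>x. \<bar>f x\<bar> * \<bar>g x\<bar> \<partial>M)\<^sup>2 \<le> (L2_norm M f * L2_norm M g)\<^sup>2"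
    by (simp add: ennreal_power ennreal_mult[symmetric] power_mult_distrib)
  then have "(\<integral>x. \<bar>f x\<bar> * \<bar>g x\<bar> \<partial>M) \<le> L2_norm M f * L2_norm M g"
    by (rule power2_le_imp_le) (simp add: L2_norm_nonneg)
  moreover have "\<bar>\<integral>x. f x * g x \<partial>M\<bar> \<le> (\<integral>x. \<bar>f x\<bar> * \<bar>g x\<bar> \<partial>M)"
    using integral_abs_bound[of M "\<lambda>x. f x * g x"] by (simp add: abs_mult)
  ultimately show ?thesis by simp
qed

lemma L1_le_L2_norm:
  fixes f :: "'a \<Rightarrow> real"
  assumes [measurable]: "f \<in> borel_measurable M" and f: "integrable M (\<lambda>x. (f x)\<^sup>2)"
  shows "(\<integral>x. \<bar>f x\<bar> \<partial>M) \<le> L2_norm M f"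
  using L2_Cauchy_Schwarz[of "\<lambda>x. \<bar>f x\<bar>" "\<lambda>_. 1"] f
  by (simp add: L2_norm_def prob_space)

lemma L2_norm_bound:
  fixes f :: "'a \<Rightarrow> real"
  assumes [measurable]: "f \<in> borel_measurable M" and "\<And>x. \<bar>f x\<bar> \<le> c"
  shows "integrable M (\<lambda>x. (f x)\<^sup>2)" "L2_norm M f \<le> c"
proof -
  have c: "0 \<le> c" using assms(2)[of undefined] by linarith
  have le: "(f x)\<^sup>2 \<le> c\<^sup>2" for x
    using assms(2)[of x] c by (simp add: abs_le_square_iff[symmetric])
  show i: "integrable M (\<lambda>x. (f x)\<^sup>2)"
    using le by (intro integrable_const_bound[of _ "c\<^sup>2"]) auto
  have "(\<integral>x. (f x)\<^sup>2 \<partial>M) \<le> (\<integral>x. c\<^sup>2 \<partial>M)"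
    using le i by (intro integral_mono) auto
  then show "L2_norm M f \<le> c"
    using c by (simp add: L2_norm_def prob_space real_le_lsqrt)
qed

text \<open>The bound involves only the norms of \<open>f\<close> and of the difference, so that \<open>g\<close> may vary with a parameter
over which no uniform control is available.\<close>

lemma diff_L2_norm_squares:
  fixes f g :: "'a \<Rightarrow> real"
  assumes [measurable]: "f \<in> borel_measurable M" "g \<in> borel_measurable M"
    and f: "integrable M (\<lambda>x. (f x)\<^sup>2)" and g: "integrable M (\<lambda>x. (g x)\<^sup>2)"
  shows "\<bar>(\<integral>x. (f x)\<^sup>2 \<partial>M) - (\<integral>x. (g x)\<^sup>2 \<partial>M)\<bar>
    \<le> L2_norm M (\<lambda>x. f x - g x) * (2 * L2_norm M f + L2_norm M (\<lambda>x. f x - g x))"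
proof -
  let ?d = "\<lambda>x. f x - g x"
  have d: "integrable M (\<lambda>x. (?d x)\<^sup>2)" by (rule L2_diff_integrable) fact+
  have fd: "integrable M (\<lambda>x. ?d x * f x)" by (rule L2_mult_integrable) (use f d in auto)
  have "(\<integral>x. (f x)\<^sup>2 \<partial>M) - (\<integral>x. (g x)\<^sup>2 \<partial>M) = (\<integral>x. 2 * (?d x * f x) - (?d x)\<^sup>2 \<partial>M)"
    using f g by (subst Bochner_Integration.integral_diff[symmetric])
      (auto simp: power2_eq_square algebra_simps)
  also have "\<dots> = 2 * (\<integral>x. ?d x * f x \<partial>M) - (L2_norm M ?d)\<^sup>2"
    using fd d by (simp add: L2_norm_power2)
  finally have eq: "(\<integral>x. (f x)\<^sup>2 \<partial>M) - (\<integral>x. (g x)\<^sup>2 \<partial>M) = \<dots>" .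
  have "\<bar>\<integral>x. ?d x * f x \<partial>M\<bar> \<le> L2_norm M ?d * L2_norm M f"
    by (rule L2_Cauchy_Schwarz) (use f d in auto)
  then have "\<bar>2 * (\<integral>x. ?d x * f x \<partial>M) - (L2_norm M ?d)\<^sup>2\<bar> \<le> 2 * (L2_norm M ?d * L2_norm M f) + (L2_norm M ?d)\<^sup>2"
    using zero_le_power2[of "L2_norm M ?d"] by linarith
  then show ?thesis unfolding eq
    by (simp add: distrib_left power2_eq_square mult.left_commute)
qed

end

section \<open>From dependence coefficients to covariance bounds\<close>

text \<open>Against a test variable \<open>\<Phi>\<close> known to \<open>F\<close>, the variable \<open>W\<close> may be replaced by its conditional
expectation; Cauchy-Schwarz then produces the \<open>L\<^sup>2\<close> distance that \<open>theta2\<close> measures.\<close>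

lemma (in prob_space) integral_mult_centred_le:
  fixes \<Phi> W :: "'a \<Rightarrow> real"
  assumes F: "subalgebra M F"
    and \<Phi>[measurable]: "\<Phi> \<in> borel_measurable F" and \<Phi>2: "integrable M (\<lambda>x. (\<Phi> x)\<^sup>2)"
    and W[measurable]: "W \<in> borel_measurable M" and W2: "integrable M (\<lambda>x. (W x)\<^sup>2)"
  shows "\<bar>\<integral>x. \<Phi> x * (W x - expectation W) \<partial>M\<bar>
    \<le> L2_norm M \<Phi> * L2_norm M (\<lambda>x. real_cond_exp M F W x - expectation W)"
proof -
  interpret finite_measure_subalgebra M F by unfold_locales (rule F)
  have \<Phi>M[measurable]: "\<Phi> \<in> borel_measurable M" by (rule measurable_from_subalg[OF F \<Phi>])
  have iW: "integrable M W" by (rule square_integrable_imp_integrable[OF W W2])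
  have i\<Phi>: "integrable M \<Phi>" by (rule square_integrable_imp_integrable[OF \<Phi>M \<Phi>2])
  let ?c = "real_cond_exp M F W"
  have c2: "integrable M (\<lambda>x. (?c x)\<^sup>2)"
  proof (rule Bochner_Integration.integrable_bound)
    show "integrable M (real_cond_exp M F (\<lambda>x. (W x)\<^sup>2))"
      by (rule real_cond_exp_int(1)[OF W2])
    have "AE x in M. (?c x)\<^sup>2 \<le> real_cond_exp M F (\<lambda>x. (W x)\<^sup>2) x"
      by (rule real_cond_exp_jensens_inequality(2)[where I=UNIV])
        (use iW W2 in \<open>auto intro: convex_power2\<close>)
    then show "AE x in M. norm ((?c x)\<^sup>2) \<le> norm (real_cond_exp M F (\<lambda>x. (W x)\<^sup>2) x)"
      by eventually_elim simp
  qed (intro borel_measurable_power borel_measurable_cond_exp2)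
  have \<Phi>W: "integrable M (\<lambda>x. \<Phi> x * W x)" by (rule L2_mult_integrable) fact+
  have "(\<integral>x. \<Phi> x * (W x - expectation W) \<partial>M) = (\<integral>x. \<Phi> x * W x \<partial>M) - expectation W * expectation \<Phi>"
    using \<Phi>W i\<Phi> by (simp add: right_diff_distrib mult.commute)
  also have "\<dots> = (\<integral>x. \<Phi> x * ?c x \<partial>M) - expectation W * expectation \<Phi>"
    using real_cond_exp_intg(2)[OF \<Phi>W] by simp
  also have "\<dots> = (\<integral>x. \<Phi> x * (?c x - expectation W) \<partial>M)"
    using real_cond_exp_intg(1)[OF \<Phi>W] i\<Phi> by (simp add: right_diff_distrib mult.commute)
  finally show ?thesis
    using L2_Cauchy_Schwarz[of \<Phi> "\<lambda>x. ?c x - expectation W"] \<Phi>2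
      L2_diff_integrable[of ?c "\<lambda>_. expectation W"] c2 by simp
qed

text \<open>The nested suprema of \<open>theta2_seq\<close> are resolved for one vector and one Lipschitz function; the
division by the length of the vector reappears as the factor \<open>l\<close>.\<close>

lemma L2_norm_cond_exp_le_theta2_seq:
  assumes le: "theta2_seq M \<xi> n \<le> ennreal g" and g: "0 \<le> g"
    and l: "l \<ge> 1" and j: "strict_mono_on {..<l} j" "p + n \<le> j 0" and f: "f \<in> Lip1 l"
  defines "W \<equiv> \<lambda>x. f (\<lambda>i\<in>{..<l}. \<xi> (j i) x)"
  shows "L2_norm M (\<lambda>x. real_cond_exp M (past_algebra M \<xi> p) W x - (\<integral>z. W z \<partial>M)) \<le> real l * g"
proof -
  let ?T = "\<lambda>p j. theta2 M (past_algebra M \<xi> p) l (\<lambda>x. \<lambda>i\<in>{..<l}. \<xi> (j i) x)"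
  let ?S = "SUP (p, j) \<in> {(p, j). strict_mono_on {..<l} j \<and> p + n \<le> j 0}. ?T p j"
  let ?N = "L2_norm M (\<lambda>x. real_cond_exp M (past_algebra M \<xi> p) W x - (\<integral>z. W z \<partial>M))"
  have "ennreal ?N \<le> ?T p j"
    unfolding theta2_def W_def by (rule SUP_upper[OF f])
  also have "\<dots> \<le> ?S"
    by (rule SUP_upper2[of "(p, j)"]) (use j in auto)
  finally have NS: "ennreal ?N \<le> ?S" .
  have "?S / of_nat l \<le> theta2_seq M \<xi> n"
    unfolding theta2_seq_def by (rule SUP_upper) (use l in auto)
  with le have S: "?S / of_nat l \<le> ennreal g" by order
  have "ennreal ?N / of_nat l \<le> ennreal g"
    using divide_right_mono_ennreal[OF NS, of "of_nat l"] S by order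
  then have "ennreal (?N / real l) \<le> ennreal g"
    using l by (simp add: ennreal_of_nat_eq_real_of_nat divide_ennreal L2_norm_def)
  then have "?N / real l \<le> g" using g by (simp add: ennreal_le_iff)
  then show ?thesis using l by (simp add: field_simps)
qed

lemma subalgebra_past_algebra:
  assumes "\<And>i. \<xi> i \<in> borel_measurable M"
  shows "subalgebra M (past_algebra M \<xi> p)"
proof -
  have "(\<Union>j\<in>{..p}. {\<xi> j -` A \<inter> space M | A. A \<in> sets borel}) \<subseteq> sets M"
    using assms by (auto intro: measurable_sets)
  then show ?thesis
    unfolding subalgebra_def past_algebra_def
    by (auto simp: space_measure_of_conv sets_measure_of_conv dest: sets.sigma_sets_subset)
qed

lemma measurable_past_algebra:
  assumes "j \<le> p"
  shows "\<xi> j \<in> borel_measurable (past_algebra M \<xi> p)"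
proof (rule measurableI)
  have sub: "(\<Union>j\<in>{..p}. {\<xi> j -` A \<inter> space M | A. A \<in> sets borel}) \<subseteq> Pow (space M)" by auto
  have sp: "space (past_algebra M \<xi> p) = space M"
    by (simp add: past_algebra_def space_measure_of_conv)
  fix A :: "real set" assume "A \<in> sets borel"
  then show "\<xi> j -` A \<inter> space (past_algebra M \<xi> p) \<in> sets (past_algebra M \<xi> p)"
    unfolding sp using assms sub
    by (auto simp: past_algebra_def sets_measure_of[OF sub] intro!: sigma_sets.Basic)
qed simp

section \<open>Weakly dependent sequences\<close>

text \<open>The dependence is recorded in the only form in which it is used: a Lipschitz function \<open>h\<close> of the sum
of \<open>l\<close> consecutive terms, each passed through a common function \<open>\<phi>\<close>, is tested against a variable
\<open>\<Phi>\<close> that is known \<open>q\<close> steps earlier. This covers covariances (\<open>l = 1\<close> and \<open>h\<close> the identity), the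
decoupling of characteristic functions (\<open>h\<close> a cosine or sine), and truncation (in \<open>\<phi>\<close>). Unlike strict
stationarity, the assumptions pass to subsequences.\<close>

locale weakly_dependent = prob_space M for M :: "'a measure" +
  fixes Y :: "nat \<Rightarrow> 'a \<Rightarrow> real" and r :: "nat \<Rightarrow> real"
  assumes Y_measurable [measurable]: "\<And>i. Y i \<in> borel_measurable M"
    and Y_ident: "\<And>i. distr M borel (Y i) = distr M borel (Y 0)"
    and Y_square: "integrable M (\<lambda>x. (Y 0 x)\<^sup>2)"
    and r_nonneg: "\<And>n. 0 \<le> r n"
    and r_antimono: "\<And>m n. 1 \<le> m \<Longrightarrow> m \<le> n \<Longrightarrow> r n \<le> r m"
    and r_small: "(\<lambda>n. real n powr (3/2) * r n) \<longlonglongrightarrow> 0"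
    and block_dependence: "\<And>\<Phi> k q l (\<phi> :: real \<Rightarrow> real) (h :: real \<Rightarrow> real) L.
      \<Phi> \<in> borel_measurable (past_algebra M Y k) \<Longrightarrow> integrable M (\<lambda>x. (\<Phi> x)\<^sup>2) \<Longrightarrow> 1 \<le> q \<Longrightarrow>
      1-lipschitz_on UNIV \<phi> \<Longrightarrow> L-lipschitz_on UNIV h \<Longrightarrow>
      \<bar>\<integral>x. \<Phi> x * (h (\<Sum>i\<in>{k+q..<k+q+l}. \<phi> (Y i x))
         - (\<integral>z. h (\<Sum>i\<in>{k+q..<k+q+l}. \<phi> (Y i z)) \<partial>M)) \<partial>M\<bar>
      \<le> L * L2_norm M \<Phi> * (real l * r q)"

lemma lipschitz_on_real_bound:
  fixes \<phi> :: "real \<Rightarrow> real"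
  assumes "L-lipschitz_on UNIV \<phi>"
  shows "\<bar>\<phi> x - \<phi> y\<bar> \<le> L * \<bar>x - y\<bar>" "0 \<le> L"
  using lipschitz_onD[OF assms, of x y] lipschitz_on_nonneg[OF assms] by (simp_all add: dist_real_def)

lemma lipschitz_on_borel_measurable:
  fixes \<phi> :: "real \<Rightarrow> real"
  assumes "L-lipschitz_on UNIV \<phi>"
  shows "\<phi> \<in> borel_measurable borel"
  using lipschitz_on_continuous_on[OF assms] by (rule borel_measurable_continuous_onI)

context prob_space
begin

lemma lipschitz_square_integrable:
  fixes \<phi> :: "real \<Rightarrow> real"
  assumes "L-lipschitz_on UNIV \<phi>" and [measurable]: "f \<in> borel_measurable M"
    and f: "integrable M (\<lambda>x. (f x)\<^sup>2)"
  shows "integrable M (\<lambda>x. (\<phi> (f x))\<^sup>2)"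
proof (rule Bochner_Integration.integrable_bound)
  have [measurable]: "\<phi> \<in> borel_measurable borel"
    by (rule lipschitz_on_borel_measurable) fact
  show "(\<lambda>x. (\<phi> (f x))\<^sup>2) \<in> borel_measurable M" by measurable
  show "integrable M (\<lambda>x. (\<bar>\<phi> 0\<bar> + L * \<bar>f x\<bar>)\<^sup>2)"
  proof (rule L2_add_integrable)
    show "integrable M (\<lambda>x. (L * \<bar>f x\<bar>)\<^sup>2)" using f by (simp add: power_mult_distrib)
  qed auto
  show "AE x in M. norm ((\<phi> (f x))\<^sup>2) \<le> norm ((\<bar>\<phi> 0\<bar> + L * \<bar>f x\<bar>)\<^sup>2)"
  proof (rule AE_I2)
    fix x
    have "\<bar>\<phi> (f x)\<bar> \<le> \<bar>\<phi> 0\<bar> + L * \<bar>f x\<bar>"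
      using lipschitz_on_real_bound(1)[OF assms(1), of "f x" 0] by simp
    moreover have "\<dots> = \<bar>\<bar>\<phi> 0\<bar> + L * \<bar>f x\<bar>\<bar>"
      using lipschitz_on_real_bound(2)[OF assms(1)] by simp
    ultimately have "(\<phi> (f x))\<^sup>2 \<le> (\<bar>\<phi> 0\<bar> + L * \<bar>f x\<bar>)\<^sup>2"
      by (simp only: abs_le_square_iff[symmetric])
    then show "norm ((\<phi> (f x))\<^sup>2) \<le> norm ((\<bar>\<phi> 0\<bar> + L * \<bar>f x\<bar>)\<^sup>2)"
      by simp
  qed
qed

end

context weakly_dependent
begin

lemma r_summable: "summable r"
proof (rule summable_comparison_test_ev)
  have "\<forall>\<^sub>F n in sequentially. real n powr (3/2) * r n < 1"
    by (rule order_tendstoD(2)[OF r_small]) simp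
  then show "\<forall>\<^sub>F n in sequentially. norm (r n) \<le> real n powr (-3/2)"
    using eventually_gt_at_top[of 0]
  proof eventually_elim
    case (elim n)
    then show ?case using r_nonneg[of n] by (simp add: powr_minus field_simps)
  qed
  show "summable (\<lambda>n. real n powr (-3/2))" by (subst summable_real_powr_iff) simp
qed

definition tail :: "nat \<Rightarrow> real" where
  "tail q = (\<Sum>n. r (n + q))"

lemma tail_nonneg: "0 \<le> tail q"
  unfolding tail_def using r_summable r_nonneg by (intro suminf_nonneg) (auto simp: summable_iff_shift)

lemma tail_tendsto_zero: "tail \<longlonglongrightarrow> 0"
proof -
  have "tail = (\<lambda>q. suminf r - sum r {..<q})"
    using suminf_minus_initial_segment[OF r_summable] by (simp add: tail_def fun_eq_iff)
  moreover have "(\<lambda>q. suminf r - sum r {..<q}) \<longlonglongrightarrow> suminf r - suminf r"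
    by (intro tendsto_intros summable_LIMSEQ r_summable)
  ultimately show ?thesis by simp
qed

lemma sum_r_le_tail:
  assumes "finite A" "inj_on f A" "\<And>i. i \<in> A \<Longrightarrow> q \<le> f i"
  shows "(\<Sum>i\<in>A. r (f i)) \<le> tail q"
proof -
  have "inj_on (\<lambda>i. f i - q) A"
    using assms(2,3) by (smt (verit) eq_diff_iff inj_on_def)
  then have "(\<Sum>i\<in>A. r (f i)) = (\<Sum>n\<in>(\<lambda>i. f i - q) ` A. r (n + q))"
    using assms(3) by (simp add: sum.reindex)
  also have "\<dots> \<le> tail q"
    unfolding tail_def using assms(1) r_summable r_nonneg
    by (intro sum_le_suminf) (auto simp: summable_iff_shift)
  finally show ?thesis .
qed

lemma integral_Y_eq:
  fixes f :: "real \<Rightarrow> real"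
  assumes [measurable]: "f \<in> borel_measurable borel"
  shows "(\<integral>x. f (Y i x) \<partial>M) = (\<integral>x. f (Y 0 x) \<partial>M)"
  using integral_distr[of "Y i" M borel f] integral_distr[of "Y 0" M borel f] Y_ident[of i] by simp

lemma Y_square_integrable: "integrable M (\<lambda>x. (Y i x)\<^sup>2)"
  using integrable_distr_eq[of "Y i" M borel "\<lambda>x. x\<^sup>2"] integrable_distr_eq[of "Y 0" M borel "\<lambda>x. x\<^sup>2"]
    Y_ident[of i] Y_square by simp

end

text \<open>The central limit theorem is applied to the centred sequence and, in its proof, to truncated
versions and their remainders. All of them have the form \<open>\<phi> (Y i)\<close> with one centred 1-Lipschitz
function \<open>\<phi>\<close>.\<close>

locale weakly_dependent_transform = weakly_dependent M Y r
  for M :: "'a measure" and Y r +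
  fixes \<phi> :: "real \<Rightarrow> real"
  assumes \<phi>_lipschitz: "1-lipschitz_on UNIV \<phi>"
    and \<phi>_mean_zero: "expectation (\<lambda>x. \<phi> (Y 0 x)) = 0"
begin

definition \<sigma> :: real where
  "\<sigma> = L2_norm M (\<lambda>x. \<phi> (Y 0 x))"

text \<open>The variance of a sum of \<open>n\<close> distinct terms is at most \<open>C * n\<close>. The essential point is that \<open>C\<close> tends to
zero with \<open>\<sigma>\<close>, which makes truncation remainders negligible.\<close>

definition C :: real where
  "C = \<sigma> * (\<sigma> + 2 * tail 1)"

definition S :: "nat set \<Rightarrow> 'a \<Rightarrow> real" where
  "S I x = (\<Sum>i\<in>I. \<phi> (Y i x))"

lemma \<sigma>_nonneg: "0 \<le> \<sigma>" and C_nonneg: "0 \<le> C"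
  by (simp_all add: \<sigma>_def C_def L2_norm_nonneg tail_nonneg)

lemma \<phi>_measurable [measurable]: "\<phi> \<in> borel_measurable borel"
  by (rule lipschitz_on_borel_measurable[OF \<phi>_lipschitz])

lemma S_measurable [measurable]: "S I \<in> borel_measurable M"
  unfolding S_def[abs_def] by measurable

lemma S_measurable_past:
  assumes "I \<subseteq> {..k}"
  shows "S I \<in> borel_measurable (past_algebra M Y k)"
  unfolding S_def[abs_def] using assms
  by (intro borel_measurable_sum measurable_compose[OF measurable_past_algebra \<phi>_measurable]) auto

lemma \<phi>_Y_square_integrable: "integrable M (\<lambda>x. (\<phi> (Y i x))\<^sup>2)"
  by (rule lipschitz_square_integrable[OF \<phi>_lipschitz _ Y_square_integrable]) simp

lemma S_square_integrable: "integrable M (\<lambda>x. (S I x)\<^sup>2)"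
  unfolding S_def by (rule L2_sum_integrable) (auto intro: \<phi>_Y_square_integrable)

lemma S_integrable: "integrable M (S I)"
  by (rule square_integrable_imp_integrable[OF S_measurable S_square_integrable])

lemma \<phi>_Y_mean_zero: "expectation (\<lambda>x. \<phi> (Y i x)) = 0"
  using integral_Y_eq[of \<phi> i] \<phi>_mean_zero by simp

lemma S_mean_zero: "expectation (S I) = 0"
proof -
  have "integrable M (\<lambda>x. \<phi> (Y i x))" for i
    by (rule square_integrable_imp_integrable[OF _ \<phi>_Y_square_integrable]) simp
  then show ?thesis unfolding S_def[abs_def]
    by (simp add: \<phi>_Y_mean_zero)
qed

lemma L2_norm_\<phi>_Y: "L2_norm M (\<lambda>x. \<phi> (Y i x)) = \<sigma>"
  unfolding \<sigma>_def L2_norm_def using integral_Y_eq[of "\<lambda>x. (\<phi> x)\<^sup>2" i] by simp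

lemma covariance_le:
  assumes "i < k"
  shows "\<bar>\<integral>x. \<phi> (Y i x) * \<phi> (Y k x) \<partial>M\<bar> \<le> \<sigma> * r (k - i)"
proof -
  have "\<bar>\<integral>x. \<phi> (Y i x) * (id (\<Sum>n\<in>{i+(k-i)..<i+(k-i)+1}. \<phi> (Y n x))
         - (\<integral>z. id (\<Sum>n\<in>{i+(k-i)..<i+(k-i)+1}. \<phi> (Y n z)) \<partial>M)) \<partial>M\<bar>
      \<le> 1 * L2_norm M (\<lambda>x. \<phi> (Y i x)) * (real 1 * r (k - i))"
  proof (rule block_dependence[where \<Phi>="\<lambda>x. \<phi> (Y i x)" and k=i and q="k - i" and l=1 and h=id and L=1 and \<phi>=\<phi>])
    show "(\<lambda>x. \<phi> (Y i x)) \<in> borel_measurable (past_algebra M Y i)"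
      by (rule measurable_compose[OF measurable_past_algebra \<phi>_measurable]) simp
    show "1-lipschitz_on UNIV (id :: real \<Rightarrow> real)"
      by (simp add: lipschitz_on_def)
  qed (use assms \<phi>_lipschitz \<phi>_Y_square_integrable in auto)
  then show ?thesis
    using assms by (simp add: L2_norm_\<phi>_Y \<phi>_Y_mean_zero)
qed

lemma covariance_S:
  "(\<integral>x. S I x * S K x \<partial>M) = (\<Sum>k\<in>K. \<Sum>i\<in>I. \<integral>x. \<phi> (Y i x) * \<phi> (Y k x) \<partial>M)"
proof -
  have int: "integrable M (\<lambda>x. \<phi> (Y i x) * \<phi> (Y k x))" for i k
    by (rule L2_mult_integrable) (auto intro: \<phi>_Y_square_integrable)
  have "(\<integral>x. S I x * S K x \<partial>M) = (\<integral>x. (\<Sum>k\<in>K. \<Sum>i\<in>I. \<phi> (Y i x) * \<phi> (Y k x)) \<partial>M)"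
    by (simp add: S_def sum_product sum.swap[of _ I K])
  also have "\<dots> = (\<Sum>k\<in>K. \<Sum>i\<in>I. \<integral>x. \<phi> (Y i x) * \<phi> (Y k x) \<partial>M)"
    using int by (simp add: Bochner_Integration.integral_sum)
  finally show ?thesis .
qed

text \<open>Each index in \<open>B\<close> interacts with the indices of \<open>A\<close> only through distances of at least \<open>q\<close>, and these
distances are pairwise different. The bound is therefore linear in the size of \<open>B\<close> and free of the
size of \<open>A\<close>.\<close>

lemma covariance_S_separated:
  assumes "A \<subseteq> {..k}" "B \<subseteq> {k+q..}" "finite B" "1 \<le> q"
  shows "\<bar>\<integral>x. S A x * S B x \<partial>M\<bar> \<le> real (card B) * (\<sigma> * tail q)"
proof -
  have fA: "finite A" using assms(1) finite_subset by blast
  have "\<bar>\<integral>x. S A x * S B x \<partial>M\<bar> \<le> (\<Sum>b\<in>B. \<Sum>a\<in>A. \<bar>\<integral>x. \<phi> (Y a x) * \<phi> (Y b x) \<partial>M\<bar>)"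
    unfolding covariance_S by (rule order_trans[OF sum_abs sum_mono[OF sum_abs]])
  also have "\<dots> \<le> (\<Sum>b\<in>B. \<sigma> * tail q)"
  proof (rule sum_mono)
    fix b assume b: "b \<in> B"
    have lt: "a + q \<le> b" if "a \<in> A" for a using b that assms(1,2) by fastforce
    have inj: "inj_on (\<lambda>a. b - a) A"
    proof (rule inj_onI)
      fix a a' assume "a \<in> A" "a' \<in> A" "b - a = b - a'"
      then show "a = a'" using lt[of a] lt[of a'] by linarith
    qed
    have "(\<Sum>a\<in>A. \<bar>\<integral>x. \<phi> (Y a x) * \<phi> (Y b x) \<partial>M\<bar>) \<le> (\<Sum>a\<in>A. \<sigma> * r (b - a))"
      using lt assms(4) by (intro sum_mono covariance_le) fastforce
    also have "\<dots> \<le> \<sigma> * tail q"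
      unfolding sum_distrib_left[symmetric]
      by (intro mult_left_mono sum_r_le_tail fA inj \<sigma>_nonneg) (auto dest!: lt)
    finally show "(\<Sum>a\<in>A. \<bar>\<integral>x. \<phi> (Y a x) * \<phi> (Y b x) \<partial>M\<bar>) \<le> \<sigma> * tail q" .
  qed
  finally show ?thesis by simp
qed

lemma variance_S_le:
  assumes "finite I"
  shows "(\<integral>x. (S I x)\<^sup>2 \<partial>M) \<le> C * real (card I)"
proof -
  have "(\<integral>x. (S I x)\<^sup>2 \<partial>M) \<le> (\<Sum>k\<in>I. \<Sum>i\<in>I. \<bar>\<integral>x. \<phi> (Y i x) * \<phi> (Y k x) \<partial>M\<bar>)"
    unfolding power2_eq_square covariance_S
    by (rule order_trans[OF abs_ge_self order_trans[OF sum_abs sum_mono[OF sum_abs]]])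
  also have "\<dots> \<le> (\<Sum>k\<in>I. C)"
  proof (rule sum_mono)
    fix k assume k: "k \<in> I"
    let ?c = "\<lambda>i. \<bar>\<integral>x. \<phi> (Y i x) * \<phi> (Y k x) \<partial>M\<bar>"
    have eq: "I = {i\<in>I. i < k} \<union> ({k} \<union> {i\<in>I. k < i})" using k by auto
    have "sum ?c I = sum ?c {i\<in>I. i < k} + (?c k + sum ?c {i\<in>I. k < i})"
      using assms by (subst eq, subst sum.union_disjoint) (auto simp: sum.insert)
    moreover have "sum ?c {i\<in>I. i < k} \<le> \<sigma> * tail 1"
    proof -
      have "sum ?c {i\<in>I. i < k} \<le> (\<Sum>i\<in>{i\<in>I. i < k}. \<sigma> * r (k - i))"
        by (intro sum_mono covariance_le) simp
      also have "\<dots> \<le> \<sigma> * tail 1"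
        unfolding sum_distrib_left[symmetric] using assms
        by (intro mult_left_mono sum_r_le_tail \<sigma>_nonneg) (fastforce intro!: inj_onI)+
      finally show ?thesis .
    qed
    moreover have "sum ?c {i\<in>I. k < i} \<le> \<sigma> * tail 1"
    proof -
      have "sum ?c {i\<in>I. k < i} \<le> (\<Sum>i\<in>{i\<in>I. k < i}. \<sigma> * r (i - k))"
        using covariance_le[of k] by (intro sum_mono) (simp add: mult.commute)
      also have "\<dots> \<le> \<sigma> * tail 1"
        unfolding sum_distrib_left[symmetric] using assms
        by (intro mult_left_mono sum_r_le_tail \<sigma>_nonneg) (fastforce intro!: inj_onI)+
      finally show ?thesis .
    qed
    moreover have "?c k = \<sigma>\<^sup>2"
      using L2_norm_power2[of "\<lambda>x. \<phi> (Y k x)"] by (simp add: L2_norm_\<phi>_Y power2_eq_square)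
    ultimately show "sum ?c I \<le> C"
      by (simp add: C_def algebra_simps power2_eq_square)
  qed
  finally show ?thesis by (simp add: mult.commute)
qed

lemma L2_norm_S_le: "finite I \<Longrightarrow> L2_norm M (S I) \<le> sqrt (C * real (card I))"
  unfolding L2_norm_def by (intro real_sqrt_le_mono variance_S_le)

end

section \<open>Elementary estimates for exponentials\<close>

lemma abs_cos_diff_le: "\<bar>cos x - cos y\<bar> \<le> \<bar>x - y :: real\<bar>"
proof -
  have "\<bar>cos x - cos y\<bar> = 2 * (\<bar>sin ((x + y) / 2)\<bar> * \<bar>sin ((y - x) / 2)\<bar>)"
    by (simp add: cos_diff_cos abs_mult)
  also have "\<dots> \<le> 2 * (1 * \<bar>(y - x) / 2\<bar>)"
    by (intro mult_left_mono mult_mono abs_sin_le_one abs_sin_x_le_abs_x) auto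
  finally show ?thesis by simp
qed

lemma abs_sin_diff_le: "\<bar>sin x - sin y\<bar> \<le> \<bar>x - y :: real\<bar>"
  using abs_cos_diff_le[of "pi/2 - x" "pi/2 - y"] by (simp add: cos_diff)

lemma lipschitz_cos_scaled: "\<bar>\<theta>\<bar>-lipschitz_on UNIV (\<lambda>u. cos (\<theta> * u :: real))"
  and lipschitz_sin_scaled: "\<bar>\<theta>\<bar>-lipschitz_on UNIV (\<lambda>u. sin (\<theta> * u :: real))"
  using abs_cos_diff_le[of "\<theta> * _" "\<theta> * _"] abs_sin_diff_le[of "\<theta> * _" "\<theta> * _"]
  by (auto intro!: lipschitz_onI simp: dist_real_def abs_mult[symmetric] right_diff_distrib)

lemma iexp_cos_sin: "iexp x = complex_of_real (cos x) + \<i> * complex_of_real (sin x)"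
  by (simp add: exp_Euler cos_of_real sin_of_real)

lemma norm_iexp_diff_le: "cmod (iexp x - iexp y) \<le> \<bar>x - y\<bar>"
proof -
  have "iexp x - iexp y = iexp y * (iexp (x - y) - 1)"
    by (simp add: right_diff_distrib exp_diff)
  then have "cmod (iexp x - iexp y) = cmod (iexp (x - y) - 1)"
    by (simp add: norm_mult)
  also have "\<dots> \<le> \<bar>x - y\<bar>"
    using iexp_approx1[of "x - y" 0] by simp
  finally show ?thesis .
qed

lemma abs_exp_minus_diff_le:
  assumes "0 \<le> x" "0 \<le> y"
  shows "\<bar>exp (- x) - exp (- y)\<bar> \<le> \<bar>x - y :: real\<bar>"
proof -
  have *: "\<bar>exp (- x) - exp (- y)\<bar> \<le> y - x" if "0 \<le> x" "x \<le> y" for x y :: real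
  proof -
    have "exp (- x) - exp (- y) = exp (- x) * (1 - exp (- (y - x)))"
      by (simp add: right_diff_distrib exp_add[symmetric])
    also have "\<dots> \<le> 1 * (y - x)"
      using that exp_ge_add_one_self[of "-(y - x)"]
      by (intro mult_mono) (auto simp del: exp_ge_add_one_self)
    finally show ?thesis using that by simp
  qed
  show ?thesis using *[of x y] *[of y x] assms by (cases "x \<le> y") auto
qed

lemma abs_exp_minus_linear_le:
  assumes "0 \<le> x"
  shows "\<bar>exp (- x) - (1 - x)\<bar> \<le> (x::real)\<^sup>2"
proof -
  have "exp (- x) \<le> 1 / (1 + x)"
    using exp_ge_add_one_self[of x] assms by (simp add: exp_minus field_simps)
  also have "1 / (1 + x) \<le> 1 - x + x\<^sup>2"
  proof -
    have "(1 - x + x\<^sup>2) * (1 + x) = 1 + x ^ 3" by (simp add: algebra_simps power2_eq_square power3_eq_cube)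
    then show ?thesis using assms by (simp add: divide_le_eq)
  qed
  finally show ?thesis using exp_ge_add_one_self[of "-x"] by (simp del: exp_ge_add_one_self)
qed

lemma (in prob_space) norm_expectation_iexp_diff_le:
  fixes f g :: "'a \<Rightarrow> real"
  assumes [measurable]: "f \<in> borel_measurable M" "g \<in> borel_measurable M"
    and f: "integrable M (\<lambda>x. (f x)\<^sup>2)" and g: "integrable M (\<lambda>x. (g x)\<^sup>2)"
  shows "cmod ((\<integral>x. iexp (\<theta> * f x) \<partial>M) - (\<integral>x. iexp (\<theta> * g x) \<partial>M)) \<le> \<bar>\<theta>\<bar> * L2_norm M (\<lambda>x. f x - g x)"
proof -
  let ?d = "\<lambda>x. f x - g x"
  have d2: "integrable M (\<lambda>x. (?d x)\<^sup>2)" by (rule L2_diff_integrable) fact+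
  have d1: "integrable M ?d" by (rule square_integrable_imp_integrable[OF _ d2]) simp
  have int: "integrable M (\<lambda>x. iexp (\<theta> * h x))" if [measurable]: "h \<in> borel_measurable M" for h
    by (rule integrable_const_bound[of _ 1]) auto
  have "cmod ((\<integral>x. iexp (\<theta> * f x) \<partial>M) - (\<integral>x. iexp (\<theta> * g x) \<partial>M))
      = cmod (\<integral>x. iexp (\<theta> * f x) - iexp (\<theta> * g x) \<partial>M)"
    by (simp only: Bochner_Integration.integral_diff[OF int[OF assms(1)] int[OF assms(2)]])
  also have "\<dots> \<le> (\<integral>x. \<bar>\<theta>\<bar> * \<bar>?d x\<bar> \<partial>M)"
  proof (rule order_trans[OF integral_norm_bound integral_mono])
    show "cmod (iexp (\<theta> * f x) - iexp (\<theta> * g x)) \<le> \<bar>\<theta>\<bar> * \<bar>?d x\<bar>" for x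
      using norm_iexp_diff_le[of "\<theta> * f x" "\<theta> * g x"] by (simp add: abs_mult[symmetric] right_diff_distrib)
  qed (use int d1 in auto)
  also have "\<dots> \<le> \<bar>\<theta>\<bar> * L2_norm M ?d"
    using L1_le_L2_norm[of ?d] d2 by (simp add: mult_left_mono)
  finally show ?thesis .
qed

section \<open>Decoupling of separated blocks\<close>

text \<open>The first \<open>J\<close> blocks of length \<open>p\<close>, each preceded by a gap of length \<open>q\<close>. With the gap in front, every
index of an earlier block is smaller than the left end of the gap before block \<open>J\<close>, which is the
multiple \<open>J * (q + p)\<close> of the period.\<close>

definition blocks :: "nat \<Rightarrow> nat \<Rightarrow> nat \<Rightarrow> nat set" where
  "blocks q p J = (\<Union>j<J. {j * (q + p) + q..<j * (q + p) + q + p})"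

lemma blocks_0 [simp]: "blocks q p 0 = {}"
  by (simp add: blocks_def)

lemma blocks_Suc: "blocks q p (Suc J) = blocks q p J \<union> {J * (q + p) + q..<J * (q + p) + q + p}"
  by (simp add: blocks_def lessThan_Suc Un_commute)

lemma finite_blocks [simp]: "finite (blocks q p J)"
  by (simp add: blocks_def)

lemma blocks_subset: "blocks q p J \<subseteq> {..<J * (q + p)}"
proof (induction J)
  case (Suc J)
  then show ?case by (auto simp: blocks_Suc algebra_simps)
qed simp

lemma blocks_disjoint: "blocks q p J \<inter> {J * (q + p) + q..<J * (q + p) + q + p} = {}"
  using blocks_subset[of q p J] by fastforce

lemma card_blocks: "card (blocks q p J) = J * p"
proof (induction J)
  case (Suc J)
  then show ?case by (simp add: blocks_Suc card_Un_disjoint blocks_disjoint)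
qed simp

context weakly_dependent_transform
begin

lemma S_Un: "finite A \<Longrightarrow> finite B \<Longrightarrow> A \<inter> B = {} \<Longrightarrow> S (A \<union> B) x = S A x + S B x"
  by (simp add: S_def sum.union_disjoint)

definition cf :: "real \<Rightarrow> nat set \<Rightarrow> complex" where
  "cf \<theta> I = (\<integral>x. iexp (\<theta> * S I x) \<partial>M)"

lemma integrable_iexp_S: "integrable M (\<lambda>x. iexp (\<theta> * S I x))"
  by (rule integrable_const_bound[of _ 1]) auto

lemma norm_cf_le: "cmod (cf \<theta> I) \<le> 1"
proof -
  have "cmod (cf \<theta> I) \<le> (\<integral>x. cmod (iexp (\<theta> * S I x)) \<partial>M)"
    unfolding cf_def by (rule integral_norm_bound)
  then show ?thesis by (simp add: prob_space)
qed

lemma bounded_past_decoupling: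
  assumes A: "A \<subseteq> {..k}" and q: "1 \<le> q" and B: "B = {k+q..<k+q+l}"
    and f[measurable]: "f \<in> borel_measurable borel" and f1: "\<And>u. \<bar>f u\<bar> \<le> 1" and h: "L-lipschitz_on UNIV h"
  shows "\<bar>\<integral>x. f (S A x) * (h (S B x) - (\<integral>z. h (S B z) \<partial>M)) \<partial>M\<bar> \<le> L * (real l * r q)"
proof -
  let ?\<Phi> = "\<lambda>x. f (S A x)"
  have \<Phi>2: "integrable M (\<lambda>x. (?\<Phi> x)\<^sup>2)" and \<Phi>1: "L2_norm M ?\<Phi> \<le> 1"
    using L2_norm_bound[of ?\<Phi> 1] f1 by simp_all
  have "\<bar>\<integral>x. ?\<Phi> x * (h (S B x) - (\<integral>z. h (S B z) \<partial>M)) \<partial>M\<bar> \<le> L * L2_norm M ?\<Phi> * (real l * r q)"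
    unfolding B S_def
    by (rule block_dependence[where \<Phi>="\<lambda>x. f (\<Sum>i\<in>A. \<phi> (Y i x))" and k=k and q=q and l=l and h=h and L=L and \<phi>=\<phi>])
      (use \<Phi>2 q h \<phi>_lipschitz measurable_compose[OF S_measurable_past[OF A] f] in \<open>auto simp: S_def\<close>)
  also have "\<dots> \<le> L * 1 * (real l * r q)"
    using \<Phi>1 lipschitz_on_nonneg[OF h] r_nonneg[of q]
    by (intro mult_right_mono mult_left_mono) auto
  finally show ?thesis by simp
qed

text \<open>Up to a remainder, the block \<open>B\<close> is independent of its past \<open>A\<close>. With \<open>c\<close> the value of \<open>cf \<theta> B\<close>, the
difference is the expectation of \<open>exp (\<i> * \<theta> * S A) * (exp (\<i> * \<theta> * S B) - c)\<close>. In real and imaginary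
parts it consists of four covariances between a variable bounded by 1 and a \<open>\<bar>\<theta>\<bar>\<close>-Lipschitz function
of the block sum.\<close>

lemma cf_decoupling:
  assumes A: "A \<subseteq> {..k}" and q: "1 \<le> q" and B: "B = {k+q..<k+q+l}"
  shows "cmod (cf \<theta> (A \<union> B) - cf \<theta> A * cf \<theta> B) \<le> 4 * (\<bar>\<theta>\<bar> * (real l * r q))"
proof -
  let ?c = "\<lambda>u. cos (\<theta> * u)" and ?s = "\<lambda>u. sin (\<theta> * u)"
  have c: "?c \<in> {?c, ?s}" and s: "?s \<in> {?c, ?s}" by simp_all
  have finA: "finite A" using A finite_subset by blast
  have disj: "A \<inter> B = {}" using A q unfolding B by fastforce
  let ?D = "\<lambda>h x. h (S B x) - (\<integral>z. h (S B z) \<partial>M)"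
  let ?I = "\<lambda>f h. \<integral>x. f (S A x) * ?D h x \<partial>M"
  have trig: "integrable M (\<lambda>x. f (S I x))" if "f \<in> {?c, ?s}" for f I
    using that by (intro integrable_const_bound[of _ 1]) auto
  have int: "integrable M (\<lambda>x. f (S A x) * ?D h x)" if fh: "f \<in> {?c, ?s}" "h \<in> {?c, ?s}" for f h
  proof (rule L2_mult_integrable)
    have [measurable]: "f \<in> borel_measurable borel" "h \<in> borel_measurable borel" using fh by auto
    show "(\<lambda>x. f (S A x)) \<in> borel_measurable M" "?D h \<in> borel_measurable M" by measurable
    show "integrable M (\<lambda>x. (f (S A x))\<^sup>2)"
      by (rule L2_norm_bound(1)[of _ 1]) (use fh in auto)
    show "integrable M (\<lambda>x. (?D h x)\<^sup>2)"
    proof (rule L2_diff_integrable)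
      show "integrable M (\<lambda>x. (h (S B x))\<^sup>2)"
        by (rule L2_norm_bound(1)[of _ 1]) (use fh in auto)
    qed auto
  qed
  have bound: "\<bar>?I f h\<bar> \<le> \<bar>\<theta>\<bar> * (real l * r q)" if "f \<in> {?c, ?s}" "h \<in> {?c, ?s}" for f h
    using that lipschitz_cos_scaled lipschitz_sin_scaled
    by (intro bounded_past_decoupling[OF A q B]) auto
  have cfB: "cf \<theta> B = complex_of_real (\<integral>z. ?c (S B z) \<partial>M) + \<i> * complex_of_real (\<integral>z. ?s (S B z) \<partial>M)"
    unfolding cf_def iexp_cos_sin using trig[OF c, of B] trig[OF s, of B] by simp
  have "cf \<theta> (A \<union> B) - cf \<theta> A * cf \<theta> B = (\<integral>x. iexp (\<theta> * S A x) * (iexp (\<theta> * S B x) - cf \<theta> B) \<partial>M)"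
  proof -
    have eq: "iexp (\<theta> * S (A \<union> B) x) = iexp (\<theta> * S A x) * iexp (\<theta> * S B x)" for x
      using finA disj by (simp add: S_Un B distrib_left exp_add)
    have i1: "integrable M (\<lambda>x. iexp (\<theta> * S A x) * iexp (\<theta> * S B x))"
      using integrable_iexp_S[of \<theta> "A \<union> B"] unfolding eq .
    have "(\<integral>x. iexp (\<theta> * S A x) * (iexp (\<theta> * S B x) - cf \<theta> B) \<partial>M)
        = (\<integral>x. iexp (\<theta> * S A x) * iexp (\<theta> * S B x) \<partial>M) - (\<integral>x. iexp (\<theta> * S A x) * cf \<theta> B \<partial>M)"
      unfolding right_diff_distrib using i1 integrable_iexp_S[of \<theta> A]
      by (intro Bochner_Integration.integral_diff integrable_mult_left) auto
    also have "\<dots> = cf \<theta> (A \<union> B) - cf \<theta> A * cf \<theta> B"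
      by (simp only: cf_def eq integral_mult_left_zero)
    finally show ?thesis by simp
  qed
  also have "\<dots> = (\<integral>x. complex_of_real (?c (S A x) * ?D ?c x) + \<i> * complex_of_real (?c (S A x) * ?D ?s x)
      + (\<i> * complex_of_real (?s (S A x) * ?D ?c x) - complex_of_real (?s (S A x) * ?D ?s x)) \<partial>M)"
    unfolding cfB iexp_cos_sin by (intro Bochner_Integration.integral_cong) (auto simp: algebra_simps)
  also have "\<dots> = complex_of_real (?I ?c ?c) + \<i> * complex_of_real (?I ?c ?s)
      + (\<i> * complex_of_real (?I ?s ?c) - complex_of_real (?I ?s ?s))"
    using int[OF c c] int[OF c s] int[OF s c] int[OF s s]
    by (simp del: of_real_mult of_real_diff)
  finally have eq: "cf \<theta> (A \<union> B) - cf \<theta> A * cf \<theta> B = \<dots>" .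
  have "cmod (complex_of_real a + \<i> * complex_of_real b + (\<i> * complex_of_real c - complex_of_real d)) \<le> 4 * e"
    if "\<bar>a\<bar> \<le> e" "\<bar>b\<bar> \<le> e" "\<bar>c\<bar> \<le> e" "\<bar>d\<bar> \<le> e" for a b c d e
    by (rule order_trans[OF cmod_le]) (use that in simp)
  from this[OF bound[OF c c] bound[OF c s] bound[OF s c] bound[OF s s]]
  show ?thesis unfolding eq .
qed

text \<open>Second order expansion of the characteristic function of one block sum. No moment beyond the second has to
be estimated: the third absolute moment is at most \<open>K * card B\<close> times the variance.\<close>

lemma cf_Taylor:
  assumes K: "\<And>u. \<bar>\<phi> u\<bar> \<le> K" and B: "finite B"
  shows "cmod (cf \<theta> B - exp (- complex_of_real (\<theta>\<^sup>2 / 2 * (\<integral>x. (S B x)\<^sup>2 \<partial>M))))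
    \<le> (\<bar>\<theta>\<bar> ^ 3 * K * C + \<theta> ^ 4 * C\<^sup>2) * (real (card B))\<^sup>2"
proof -
  define v where "v = (\<integral>x. (S B x)\<^sup>2 \<partial>M)"
  define b where "b = real (card B)"
  have K0: "0 \<le> K" using K[of 0] by linarith
  have v: "0 \<le> v" "v \<le> C * b" using variance_S_le[OF B] by (simp_all add: v_def b_def)
  have Sb: "\<bar>S B x\<bar> \<le> K * b" for x
    unfolding S_def b_def using sum_bounded_above[of B "\<lambda>i. \<bar>\<phi> (Y i x)\<bar>" K] K
    by (intro order_trans[OF sum_abs]) (simp add: mult.commute)
  have cf: "cf \<theta> B = char (distr M borel (S B)) \<theta>"
    unfolding cf_def char_def by (subst integral_distr) auto
  have "cmod (cf \<theta> B - (1 - \<theta>\<^sup>2 * v / 2))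
      \<le> (\<theta>\<^sup>2 / 6) * expectation (\<lambda>x. min (6 * (S B x)\<^sup>2) (\<bar>\<theta>\<bar> * \<bar>S B x\<bar> ^ 3))"
    unfolding cf
    by (rule char_approx3'[OF _ S_integrable S_square_integrable S_mean_zero _ refl])
      (simp_all add: S_mean_zero v_def)
  also have "\<dots> \<le> (\<theta>\<^sup>2 / 6) * (\<bar>\<theta>\<bar> * (K * b) * v)"
  proof (rule mult_left_mono)
    have "expectation (\<lambda>x. min (6 * (S B x)\<^sup>2) (\<bar>\<theta>\<bar> * \<bar>S B x\<bar> ^ 3)) \<le> expectation (\<lambda>x. \<bar>\<theta>\<bar> * (K * b) * (S B x)\<^sup>2)"
    proof (rule integral_mono)
      show "integrable M (\<lambda>x. min (6 * (S B x)\<^sup>2) (\<bar>\<theta>\<bar> * \<bar>S B x\<bar> ^ 3))"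
        by (rule Bochner_Integration.integrable_bound[of _ "\<lambda>x. 6 * (S B x)\<^sup>2"])
          (use S_square_integrable in auto)
      show "min (6 * (S B x)\<^sup>2) (\<bar>\<theta>\<bar> * \<bar>S B x\<bar> ^ 3) \<le> \<bar>\<theta>\<bar> * (K * b) * (S B x)\<^sup>2" for x
      proof (rule min.coboundedI2)
        have "\<bar>S B x\<bar> ^ 3 = \<bar>S B x\<bar> * (S B x)\<^sup>2"
          by (simp add: power3_eq_cube power2_eq_square)
        moreover have "\<bar>S B x\<bar> * (S B x)\<^sup>2 \<le> (K * b) * (S B x)\<^sup>2"
          using Sb[of x] by (intro mult_right_mono) auto
        ultimately show "\<bar>\<theta>\<bar> * \<bar>S B x\<bar> ^ 3 \<le> \<bar>\<theta>\<bar> * (K * b) * (S B x)\<^sup>2"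
          by (simp only: mult.assoc mult_left_mono abs_ge_zero)
      qed
    qed (use S_square_integrable in auto)
    then show "expectation (\<lambda>x. min (6 * (S B x)\<^sup>2) (\<bar>\<theta>\<bar> * \<bar>S B x\<bar> ^ 3)) \<le> \<bar>\<theta>\<bar> * (K * b) * v"
      by (simp add: v_def)
  qed simp
  also have "\<dots> = (\<bar>\<theta>\<bar> ^ 3 * K * b / 6) * v"
    by (simp add: power3_eq_cube power2_eq_square)
  also have "\<dots> \<le> (\<bar>\<theta>\<bar> ^ 3 * K * b) * (C * b)"
    using v K0 by (intro mult_mono) (auto simp: b_def)
  finally have 1: "cmod (cf \<theta> B - (1 - \<theta>\<^sup>2 * v / 2)) \<le> (\<bar>\<theta>\<bar> ^ 3 * K * b) * (C * b)" .
  have "\<bar>exp (- (\<theta>\<^sup>2 / 2 * v)) - (1 - \<theta>\<^sup>2 / 2 * v)\<bar> \<le> (\<theta>\<^sup>2 / 2 * v)\<^sup>2"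
    using v by (intro abs_exp_minus_linear_le) simp
  also have "\<dots> \<le> (\<theta>\<^sup>2 * (C * b))\<^sup>2"
    using v by (intro power_mono mult_mono) auto
  finally have 2: "cmod (exp (- complex_of_real (\<theta>\<^sup>2 / 2 * v)) - (1 - \<theta>\<^sup>2 * v / 2)) \<le> (\<theta>\<^sup>2 * (C * b))\<^sup>2"
    by (metis (no_types, lifting) exp_of_real norm_of_real of_real_1 of_real_diff of_real_minus times_divide_eq_left)
  have "cmod (cf \<theta> B - exp (- complex_of_real (\<theta>\<^sup>2 / 2 * v)))
      \<le> (\<bar>\<theta>\<bar> ^ 3 * K * b) * (C * b) + (\<theta>\<^sup>2 * (C * b))\<^sup>2"
    using norm_triangle_ineq4[of "cf \<theta> B - (1 - \<theta>\<^sup>2 * v / 2)"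
        "exp (- complex_of_real (\<theta>\<^sup>2 / 2 * v)) - (1 - \<theta>\<^sup>2 * v / 2)"] 1 2 by simp
  also have "\<dots> = (\<bar>\<theta>\<bar> ^ 3 * K * C + \<theta> ^ 4 * C\<^sup>2) * b\<^sup>2"
    by (simp add: power2_eq_square power4_eq_xxxx algebra_simps)
  finally show ?thesis unfolding v_def b_def .
qed

text \<open>Peeling off the last block costs one decoupling error and one Taylor error; the remaining factors have
modulus at most 1, so the errors add up.\<close>

lemma cf_blocks:
  assumes K: "\<And>u. \<bar>\<phi> u\<bar> \<le> K" and q: "1 \<le> q"
  shows "cmod (cf \<theta> (blocks q p J) - exp (- complex_of_real (\<theta>\<^sup>2 / 2 *
      (\<Sum>j<J. \<integral>x. (S {j * (q + p) + q..<j * (q + p) + q + p} x)\<^sup>2 \<partial>M))))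
    \<le> real J * (4 * (\<bar>\<theta>\<bar> * (real p * r q)) + (\<bar>\<theta>\<bar> ^ 3 * K * C + \<theta> ^ 4 * C\<^sup>2) * (real p)\<^sup>2)"
proof (induction J)
  case 0
  show ?case by (simp add: cf_def S_def prob_space)
next
  case (Suc J)
  let ?A = "blocks q p J" and ?B = "{J * (q + p) + q..<J * (q + p) + q + p}"
  define v where "v j = (\<integral>x. (S {j * (q + p) + q..<j * (q + p) + q + p} x)\<^sup>2 \<partial>M)" for j
  define a where "a = exp (- complex_of_real (\<theta>\<^sup>2 / 2 * (\<Sum>j<J. v j)))"
  define b where "b = exp (- complex_of_real (\<theta>\<^sup>2 / 2 * v J))"
  have v: "0 \<le> v j" for j by (simp add: v_def)
  have ab: "exp (- complex_of_real (\<theta>\<^sup>2 / 2 * (\<Sum>j<Suc J. v j))) = a * b"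
  proof -
    have "\<theta>\<^sup>2 / 2 * (\<Sum>j<Suc J. v j) = \<theta>\<^sup>2 / 2 * (\<Sum>j<J. v j) + \<theta>\<^sup>2 / 2 * v J"
      by (simp add: distrib_left)
    then show ?thesis by (simp only: a_def b_def of_real_add minus_add_distrib exp_add)
  qed
  have b1: "cmod b \<le> 1"
    using v[of J] by (simp add: b_def)
  have "cmod (cf \<theta> (?A \<union> ?B) - cf \<theta> ?A * cf \<theta> ?B) \<le> 4 * (\<bar>\<theta>\<bar> * (real p * r q))"
    by (rule cf_decoupling[OF _ q refl]) (use blocks_subset[of q p J] in force)
  moreover have "cmod (cf \<theta> ?A * (cf \<theta> ?B - b)) \<le> 1 * ((\<bar>\<theta>\<bar> ^ 3 * K * C + \<theta> ^ 4 * C\<^sup>2) * (real p)\<^sup>2)"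
    using cf_Taylor[OF K, of ?B \<theta>] unfolding norm_mult b_def v_def
    by (intro mult_mono norm_cf_le) auto
  moreover have "cmod ((cf \<theta> ?A - a) * b)
      \<le> (real J * (4 * (\<bar>\<theta>\<bar> * (real p * r q)) + (\<bar>\<theta>\<bar> ^ 3 * K * C + \<theta> ^ 4 * C\<^sup>2) * (real p)\<^sup>2)) * 1"
    using Suc.IH b1 unfolding norm_mult v_def[symmetric] a_def[symmetric]
    by (intro mult_mono) (auto intro: order_trans[OF norm_ge_zero])
  moreover have "cf \<theta> (?A \<union> ?B) - a * b
      = (cf \<theta> (?A \<union> ?B) - cf \<theta> ?A * cf \<theta> ?B) + cf \<theta> ?A * (cf \<theta> ?B - b) + (cf \<theta> ?A - a) * b"
    by (simp add: algebra_simps)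
  then have "cmod (cf \<theta> (?A \<union> ?B) - a * b)
      \<le> cmod (cf \<theta> (?A \<union> ?B) - cf \<theta> ?A * cf \<theta> ?B) + cmod (cf \<theta> ?A * (cf \<theta> ?B - b)) + cmod ((cf \<theta> ?A - a) * b)"
    using norm_triangle_le[OF add_right_mono[OF norm_triangle_ineq]] by metis
  ultimately have "cmod (cf \<theta> (?A \<union> ?B) - a * b)
      \<le> real (Suc J) * (4 * (\<bar>\<theta>\<bar> * (real p * r q)) + (\<bar>\<theta>\<bar> ^ 3 * K * C + \<theta> ^ 4 * C\<^sup>2) * (real p)\<^sup>2)"
    by (simp only: of_nat_Suc distrib_right mult_1_left mult_1_right)
  then show ?case unfolding blocks_Suc ab[symmetric] v_def .
qed

text \<open>The blocks are almost uncorrelated, so the variance of their sum is nearly the sum of the variances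
that appears in the Gaussian factor of the previous lemma.\<close>

lemma variance_blocks:
  assumes q: "1 \<le> q"
  shows "\<bar>(\<integral>x. (S (blocks q p J) x)\<^sup>2 \<partial>M)
      - (\<Sum>j<J. \<integral>x. (S {j * (q + p) + q..<j * (q + p) + q + p} x)\<^sup>2 \<partial>M)\<bar>
    \<le> 2 * (real (J * p) * (\<sigma> * tail q))"
proof (induction J)
  case 0
  show ?case by (simp add: S_def)
next
  case (Suc J)
  let ?A = "blocks q p J" and ?B = "{J * (q + p) + q..<J * (q + p) + q + p}"
  have "S (blocks q p (Suc J)) x = S ?A x + S ?B x" for x
    unfolding blocks_Suc by (rule S_Un) (simp_all add: blocks_disjoint)
  then have "(\<integral>x. (S (blocks q p (Suc J)) x)\<^sup>2 \<partial>M)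
      = (\<integral>x. (S ?A x)\<^sup>2 + (S ?B x)\<^sup>2 + 2 * (S ?A x * S ?B x) \<partial>M)"
    by (simp add: power2_sum mult.assoc)
  also have "\<dots> = (\<integral>x. (S ?A x)\<^sup>2 \<partial>M) + (\<integral>x. (S ?B x)\<^sup>2 \<partial>M) + 2 * (\<integral>x. S ?A x * S ?B x \<partial>M)"
    by (simp add: S_square_integrable L2_mult_integrable)
  finally have eq: "(\<integral>x. (S (blocks q p (Suc J)) x)\<^sup>2 \<partial>M) = \<dots>" .
  have "\<bar>\<integral>x. S ?A x * S ?B x \<partial>M\<bar> \<le> real (card ?B) * (\<sigma> * tail q)"
    by (rule covariance_S_separated[where k="J * (q + p)"]) (use blocks_subset[of q p J] q in force)+
  then have cross: "\<bar>\<integral>x. S ?A x * S ?B x \<partial>M\<bar> \<le> real p * (\<sigma> * tail q)" by simp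
  have "\<bar>a + b + 2 * c - (d + b)\<bar> \<le> 2 * (x + y)" if "\<bar>a - d\<bar> \<le> 2 * x" "\<bar>c\<bar> \<le> y" for a b c d x y :: real
    using that unfolding abs_le_iff by argo
  from this[OF Suc.IH cross] show ?case
    unfolding eq by (simp add: distrib_right add.commute)
qed

text \<open>Bernstein's estimate for fixed \<open>n\<close>. The quantity \<open>\<rho>\<close> bounds the proportion of indices in \<open>{..<n}\<close> that
lie in gaps or in the incomplete last period; dropping them changes the sum by at most
\<open>sqrt (C * \<rho> * n)\<close> in \<open>L\<^sup>2\<close>. The three groups of terms come from dropping these indices,
from the blocks (whose number is at most \<open>n / p\<close>), and from comparing the variances.\<close>

lemma cf_normal_approx:
  assumes K: "\<And>u. \<bar>\<phi> u\<bar> \<le> K" and q: "1 \<le> q" and p: "1 \<le> p" and n: "1 \<le> n"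
  defines "\<rho> \<equiv> real q / real p + real (q + p) / real n"
  shows "cmod (cf (t / sqrt n) {..<n} - exp (- complex_of_real (t\<^sup>2 / 2 * ((\<integral>x. (S {..<n} x)\<^sup>2 \<partial>M) / n))))
    \<le> \<bar>t\<bar> * sqrt (C * \<rho>) + 4 * \<bar>t\<bar> * (sqrt n * r q) + (\<bar>t\<bar> ^ 3 * K * C + t ^ 4 * C\<^sup>2) * (p / sqrt n)
      + t\<^sup>2 / 2 * (2 * \<sigma> * tail q + sqrt (C * \<rho>) * (2 * sqrt C + sqrt (C * \<rho>)))"
proof -
  define J where "J = n div (q + p)"
  define \<theta> where "\<theta> = t / sqrt n"
  define A where "A = blocks q p J"
  define R where "R = {..<n} - A"
  define W where "W = (\<Sum>j<J. \<integral>x. (S {j * (q + p) + q..<j * (q + p) + q + p} x)\<^sup>2 \<partial>M)"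
  define VA where "VA = (\<integral>x. (S A x)\<^sup>2 \<partial>M)"
  define V where "V = (\<integral>x. (S {..<n} x)\<^sup>2 \<partial>M)"
  have n0: "0 < real n" using n by simp
  have K0: "0 \<le> K" using K[of 0] by linarith
  have JL: "J * (q + p) \<le> n" by (simp add: J_def)
  have A: "A \<subseteq> {..<n}" "finite A" "card A = J * p"
    using blocks_subset[of q p J] JL unfolding A_def by (auto simp: card_blocks)
  have Jp: "real J * real p \<le> n"
    using JL unfolding of_nat_mult[symmetric] of_nat_le_iff by (simp add: algebra_simps)
  have \<rho>: "real (card R) \<le> n * \<rho>" "0 \<le> \<rho>"
  proof -
    have "n < Suc J * (q + p)"
      using dividend_less_div_times[of "q + p" n] q unfolding J_def by simp
    then have "card R \<le> J * q + (q + p)"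
      using A by (simp add: R_def card_Diff_subset algebra_simps)
    then have "real (card R) \<le> real J * real q + real (q + p)"
      by (metis of_nat_add of_nat_le_iff of_nat_mult)
    also have "real J * real q \<le> n * (real q / real p)"
      using mult_right_mono[OF Jp, of "real q / real p"] p by simp
    finally show "real (card R) \<le> n * \<rho>" unfolding \<rho>_def distrib_left using n0 by simp
    show "0 \<le> \<rho>" by (simp add: \<rho>_def)
  qed
  have SR: "S R x = S {..<n} x - S A x" for x
    using S_Un[of A R x] A by (simp add: R_def Un_absorb1)
  have D: "L2_norm M (\<lambda>x. S {..<n} x - S A x) \<le> sqrt n * sqrt (C * \<rho>)"
  proof -
    have "L2_norm M (S R) \<le> sqrt (C * real (card R))"
      by (rule L2_norm_S_le) (simp add: R_def)
    also have "\<dots> \<le> sqrt (n * (C * \<rho>))"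
      using mult_left_mono[OF \<rho>(1) C_nonneg] by (simp add: mult.left_commute)
    finally show ?thesis unfolding SR by (simp add: real_sqrt_mult SR[abs_def])
  qed
  have 1: "cmod (cf \<theta> {..<n} - cf \<theta> A) \<le> \<bar>t\<bar> * sqrt (C * \<rho>)"
  proof -
    have "cmod (cf \<theta> {..<n} - cf \<theta> A) \<le> \<bar>\<theta>\<bar> * L2_norm M (\<lambda>x. S {..<n} x - S A x)"
      unfolding cf_def by (rule norm_expectation_iexp_diff_le) (simp_all add: S_square_integrable)
    also have "\<dots> \<le> \<bar>\<theta>\<bar> * (sqrt n * sqrt (C * \<rho>))" by (intro mult_left_mono D) simp
    also have "\<dots> = \<bar>t\<bar> * sqrt (C * \<rho>)" using n0 by (simp add: \<theta>_def)
    finally show ?thesis .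
  qed
  have 2: "cmod (cf \<theta> A - exp (- complex_of_real (\<theta>\<^sup>2 / 2 * W)))
      \<le> 4 * \<bar>t\<bar> * (sqrt n * r q) + (\<bar>t\<bar> ^ 3 * K * C + t ^ 4 * C\<^sup>2) * (p / sqrt n)"
  proof -
    have "cmod (cf \<theta> A - exp (- complex_of_real (\<theta>\<^sup>2 / 2 * W)))
        \<le> real J * (4 * (\<bar>\<theta>\<bar> * (real p * r q)) + (\<bar>\<theta>\<bar> ^ 3 * K * C + \<theta> ^ 4 * C\<^sup>2) * (real p)\<^sup>2)"
      unfolding A_def W_def by (rule cf_blocks[OF K q])
    also have "\<dots> = (real J * real p) * (4 * \<bar>\<theta>\<bar> * r q + (\<bar>\<theta>\<bar> ^ 3 * K * C + \<theta> ^ 4 * C\<^sup>2) * p)"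
      by (simp add: algebra_simps power2_eq_square)
    also have "\<dots> \<le> n * (4 * \<bar>\<theta>\<bar> * r q + (\<bar>\<theta>\<bar> ^ 3 * K * C + \<theta> ^ 4 * C\<^sup>2) * p)"
      using Jp K0 C_nonneg r_nonneg[of q] by (intro mult_right_mono) auto
    also have "\<dots> \<le> 4 * \<bar>t\<bar> * (sqrt n * r q) + (\<bar>t\<bar> ^ 3 * K * C + t ^ 4 * C\<^sup>2) * (p / sqrt n)"
    proof -
      have s: "sqrt n * sqrt n = n" "1 \<le> sqrt n" using n by simp_all
      define s where "s = sqrt n"
      have s1: "1 \<le> s" "real n = s * s" using s by (simp_all add: s_def)
      have "n * (4 * \<bar>\<theta>\<bar> * r q) = 4 * \<bar>t\<bar> * (sqrt n * r q)"
        using s1 by (simp add: \<theta>_def s_def[symmetric] field_simps)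
      moreover have "n * (\<bar>\<theta>\<bar> ^ 3 * K * C * p) = \<bar>t\<bar> ^ 3 * K * C * (p / sqrt n)"
        using s1 by (simp add: \<theta>_def s_def[symmetric] field_simps power3_eq_cube)
      moreover have "n * (\<theta> ^ 4 * C\<^sup>2 * p) \<le> t ^ 4 * C\<^sup>2 * (p / sqrt n)"
      proof -
        have "n * (\<theta> ^ 4 * C\<^sup>2 * p) = t ^ 4 * C\<^sup>2 * (p / (s * s))"
          using s1 by (simp add: \<theta>_def s_def[symmetric] field_simps power4_eq_xxxx)
        also have "\<dots> \<le> t ^ 4 * C\<^sup>2 * (p / s)"
          using s1 by (intro mult_left_mono divide_left_mono) auto
        finally show ?thesis by (simp add: s_def)
      qed
      ultimately show ?thesis unfolding distrib_left distrib_right by linarith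
    qed
    finally show ?thesis .
  qed
  have 3: "cmod (exp (- complex_of_real (\<theta>\<^sup>2 / 2 * W)) - exp (- complex_of_real (t\<^sup>2 / 2 * (V / n))))
      \<le> t\<^sup>2 / 2 * (2 * \<sigma> * tail q + sqrt (C * \<rho>) * (2 * sqrt C + sqrt (C * \<rho>)))"
  proof -
    have W0: "0 \<le> W" and V0: "0 \<le> V" by (auto simp: W_def V_def intro!: sum_nonneg)
    have \<theta>2: "\<theta>\<^sup>2 = t\<^sup>2 / n" using n0 by (simp add: \<theta>_def power_divide)
    have "\<bar>VA - W\<bar> \<le> 2 * (real (J * p) * (\<sigma> * tail q))"
      unfolding VA_def W_def A_def by (rule variance_blocks[OF q])
    also have "\<dots> \<le> 2 * (n * (\<sigma> * tail q))"
      using Jp \<sigma>_nonneg tail_nonneg by (intro mult_left_mono mult_right_mono) auto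
    finally have VW: "\<bar>VA - W\<bar> \<le> n * (2 * \<sigma> * tail q)" by (simp add: mult_ac)
    have L: "L2_norm M (S {..<n}) \<le> sqrt n * sqrt C"
      using L2_norm_S_le[of "{..<n}"] by (simp add: real_sqrt_mult mult.commute)
    have "\<bar>V - VA\<bar> \<le> L2_norm M (\<lambda>x. S {..<n} x - S A x)
        * (2 * L2_norm M (S {..<n}) + L2_norm M (\<lambda>x. S {..<n} x - S A x))"
      unfolding V_def VA_def by (rule diff_L2_norm_squares) (simp_all add: S_square_integrable)
    also have "\<dots> \<le> (sqrt n * sqrt (C * \<rho>)) * (2 * (sqrt n * sqrt C) + sqrt n * sqrt (C * \<rho>))"
      using D L by (intro mult_mono add_mono) (auto simp: L2_norm_nonneg C_nonneg \<rho>)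
    also have "\<dots> = (sqrt n * sqrt n) * (sqrt (C * \<rho>) * (2 * sqrt C + sqrt (C * \<rho>)))"
      by (simp only: distrib_left mult_ac)
    finally have VV: "\<bar>V - VA\<bar> \<le> n * (sqrt (C * \<rho>) * (2 * sqrt C + sqrt (C * \<rho>)))" by simp
    have "cmod (exp (- complex_of_real (\<theta>\<^sup>2 / 2 * W)) - exp (- complex_of_real (t\<^sup>2 / 2 * (V / n))))
      = \<bar>exp (- (\<theta>\<^sup>2 / 2 * W)) - exp (- (t\<^sup>2 / 2 * (V / n)))\<bar>"
      by (simp only: of_real_minus[symmetric] exp_of_real of_real_diff[symmetric] norm_of_real)
    also have "\<dots> \<le> \<bar>\<theta>\<^sup>2 / 2 * W - t\<^sup>2 / 2 * (V / n)\<bar>"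
      using W0 V0 by (intro abs_exp_minus_diff_le) auto
    also have "\<dots> = t\<^sup>2 / 2 * (\<bar>W - V\<bar> / n)"
    proof -
      have "\<theta>\<^sup>2 / 2 * W - t\<^sup>2 / 2 * (V / n) = t\<^sup>2 / 2 * ((W - V) / n)"
        by (simp add: \<theta>2 right_diff_distrib diff_divide_distrib)
      then show ?thesis using n0 by (simp add: abs_mult)
    qed
    also have "\<dots> \<le> t\<^sup>2 / 2 * (2 * \<sigma> * tail q + sqrt (C * \<rho>) * (2 * sqrt C + sqrt (C * \<rho>)))"
    proof (rule mult_left_mono)
      have "\<bar>W - V\<bar> \<le> n * (2 * \<sigma> * tail q + sqrt (C * \<rho>) * (2 * sqrt C + sqrt (C * \<rho>)))"
        unfolding distrib_left[of "real n"] using VV VW by linarith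
      then show "\<bar>W - V\<bar> / n \<le> 2 * \<sigma> * tail q + sqrt (C * \<rho>) * (2 * sqrt C + sqrt (C * \<rho>))"
        using n0 by (simp add: divide_le_eq mult.commute)
    qed simp
    finally show ?thesis .
  qed
  show ?thesis
    using norm_triangle_ineq[of "cf \<theta> {..<n} - cf \<theta> A" "cf \<theta> A - exp (- complex_of_real (\<theta>\<^sup>2 / 2 * W))"]
      norm_triangle_ineq[of "cf \<theta> {..<n} - exp (- complex_of_real (\<theta>\<^sup>2 / 2 * W))"
        "exp (- complex_of_real (\<theta>\<^sup>2 / 2 * W)) - exp (- complex_of_real (t\<^sup>2 / 2 * (V / n)))"] 1 2 3
    unfolding \<theta>_def[symmetric] V_def[symmetric] by simp
qed

text \<open>Four conditions have to be met: \<open>q / p\<close>, \<open>p / n\<close>, \<open>p / sqrt n\<close> and \<open>sqrt n * r q\<close> must vanish. Since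
\<open>r q = o(q powr (-3/2))\<close>, the last one allows \<open>q\<close> of the order \<open>n powr (1/3)\<close> but no smaller, and any
exponent strictly between \<open>1/3\<close> and \<open>1/2\<close> serves for \<open>p\<close>; the midpoint is \<open>5/12\<close>.\<close>

lemma cf_normal_limit_bounded:
  assumes K: "\<And>u. \<bar>\<phi> u\<bar> \<le> K"
  shows "(\<lambda>n. cf (t / sqrt n) {..<n} - exp (- complex_of_real (t\<^sup>2 / 2 * ((\<integral>x. (S {..<n} x)\<^sup>2 \<partial>M) / n)))) \<longlonglongrightarrow> 0"
proof -
  define q where "q n = nat \<lceil>real n powr (1/3)\<rceil>" for n :: nat
  define p where "p n = nat \<lceil>real n powr (5/12)\<rceil>" for n :: nat
  define \<rho> where "\<rho> n = real (q n) / real (p n) + real (q n + p n) / real n" for n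
  have q: "real n powr (1/3) \<le> real (q n)" "real (q n) \<le> real n powr (1/3) + 1" for n
  proof -
    have "real (q n) = of_int \<lceil>real n powr (1/3)\<rceil>" by (simp add: q_def)
    then show "real n powr (1/3) \<le> real (q n)" "real (q n) \<le> real n powr (1/3) + 1"
      using ceiling_correct[of "real n powr (1/3)"] by linarith+
  qed
  have p: "real n powr (5/12) \<le> real (p n)" "real (p n) \<le> real n powr (5/12) + 1" for n
  proof -
    have "real (p n) = of_int \<lceil>real n powr (5/12)\<rceil>" by (simp add: p_def)
    then show "real n powr (5/12) \<le> real (p n)" "real (p n) \<le> real n powr (5/12) + 1"
      using ceiling_correct[of "real n powr (5/12)"] by linarith+
  qed
  have pq1: "1 \<le> p n" "1 \<le> q n" if "1 \<le> n" for n
  proof -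
    have "1 \<le> real n powr (5/12)" "1 \<le> real n powr (1/3)" using that by (simp_all add: ge_one_powr_ge_zero)
    then have "1 \<le> real (p n)" "1 \<le> real (q n)" using p(1)[of n] q(1)[of n] by linarith+
    then show "1 \<le> p n" "1 \<le> q n" by simp_all
  qed
  have q_top: "filterlim q at_top sequentially"
  proof -
    have "filterlim (\<lambda>n. real (q n)) at_top sequentially"
    proof (rule filterlim_at_top_mono)
      show "filterlim (\<lambda>n. real n powr (1/3)) at_top sequentially" by real_asymp
    qed (use q(1) in simp)
    then show ?thesis unfolding filterlim_sequentially_iff_filterlim_real .
  qed
  have \<rho>0: "\<rho> \<longlonglongrightarrow> 0"
  proof (rule tendsto_sandwich)
    show "\<forall>\<^sub>F n in sequentially. 0 \<le> \<rho> n" by (simp add: \<rho>_def)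
    show "\<forall>\<^sub>F n in sequentially. \<rho> n \<le> (real n powr (1/3) + 1) / real n powr (5/12)
        + ((real n powr (1/3) + 1) + (real n powr (5/12) + 1)) / real n"
      using eventually_gt_at_top[of 0]
    proof eventually_elim
      case (elim n)
      then show ?case unfolding \<rho>_def of_nat_add
        by (intro add_mono frac_le divide_right_mono q p) auto
    qed
    show "(\<lambda>n. (real n powr (1/3) + 1) / real n powr (5/12)
        + ((real n powr (1/3) + 1) + (real n powr (5/12) + 1)) / real n) \<longlonglongrightarrow> 0"
      by real_asymp
  qed simp
  have r0: "(\<lambda>n. sqrt n * r (q n)) \<longlonglongrightarrow> 0"
  proof (rule tendsto_sandwich)
    show "\<forall>\<^sub>F n in sequentially. 0 \<le> sqrt (real n) * r (q n)" by (simp add: r_nonneg)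
    show "\<forall>\<^sub>F n in sequentially. sqrt (real n) * r (q n) \<le> real (q n) powr (3/2) * r (q n)"
    proof (rule always_eventually, rule allI, rule mult_right_mono)
      fix n
      have "sqrt (real n) = (real n powr (1/3)) powr (3/2)" by (simp add: powr_powr powr_half_sqrt)
      also have "\<dots> \<le> real (q n) powr (3/2)" by (intro powr_mono2 q) auto
      finally show "sqrt (real n) \<le> real (q n) powr (3/2)" .
    qed (rule r_nonneg)
    show "(\<lambda>n. real (q n) powr (3/2) * r (q n)) \<longlonglongrightarrow> 0"
      by (rule filterlim_compose[OF r_small q_top])
  qed simp
  have p0: "(\<lambda>n. real (p n) / sqrt n) \<longlonglongrightarrow> 0"
  proof (rule tendsto_sandwich)
    show "\<forall>\<^sub>F n in sequentially. 0 \<le> real (p n) / sqrt (real n)" by simp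
    show "\<forall>\<^sub>F n in sequentially. real (p n) / sqrt n \<le> (real n powr (5/12) + 1) / sqrt n"
      by (intro always_eventually allI divide_right_mono p) simp
    show "(\<lambda>n. (real n powr (5/12) + 1) / sqrt n) \<longlonglongrightarrow> 0" by real_asymp
  qed simp
  have t0: "(\<lambda>n. tail (q n)) \<longlonglongrightarrow> 0"
    by (rule filterlim_compose[OF tail_tendsto_zero q_top])
  have "(\<lambda>n. \<bar>t\<bar> * sqrt (C * \<rho> n) + 4 * \<bar>t\<bar> * (sqrt n * r (q n)) + (\<bar>t\<bar> ^ 3 * K * C + t ^ 4 * C\<^sup>2) * (p n / sqrt n)
      + t\<^sup>2 / 2 * (2 * \<sigma> * tail (q n) + sqrt (C * \<rho> n) * (2 * sqrt C + sqrt (C * \<rho> n))))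
    \<longlonglongrightarrow> \<bar>t\<bar> * sqrt (C * 0) + 4 * \<bar>t\<bar> * 0 + (\<bar>t\<bar> ^ 3 * K * C + t ^ 4 * C\<^sup>2) * 0
      + t\<^sup>2 / 2 * (2 * \<sigma> * 0 + sqrt (C * 0) * (2 * sqrt C + sqrt (C * 0)))"
    by (intro tendsto_intros \<rho>0 r0 p0 t0)
  then have "(\<lambda>n. \<bar>t\<bar> * sqrt (C * \<rho> n) + 4 * \<bar>t\<bar> * (sqrt n * r (q n)) + (\<bar>t\<bar> ^ 3 * K * C + t ^ 4 * C\<^sup>2) * (p n / sqrt n)
      + t\<^sup>2 / 2 * (2 * \<sigma> * tail (q n) + sqrt (C * \<rho> n) * (2 * sqrt C + sqrt (C * \<rho> n)))) \<longlonglongrightarrow> 0"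
    by simp
  then show ?thesis
  proof (rule Lim_null_comparison[rotated])
    show "\<forall>\<^sub>F n in sequentially. cmod (cf (t / sqrt n) {..<n}
        - exp (- complex_of_real (t\<^sup>2 / 2 * ((\<integral>x. (S {..<n} x)\<^sup>2 \<partial>M) / n))))
      \<le> \<bar>t\<bar> * sqrt (C * \<rho> n) + 4 * \<bar>t\<bar> * (sqrt n * r (q n)) + (\<bar>t\<bar> ^ 3 * K * C + t ^ 4 * C\<^sup>2) * (p n / sqrt n)
      + t\<^sup>2 / 2 * (2 * \<sigma> * tail (q n) + sqrt (C * \<rho> n) * (2 * sqrt C + sqrt (C * \<rho> n)))"
      using eventually_ge_at_top[of 1]
    proof eventually_elim
      case (elim n)
      show ?case unfolding \<rho>_def by (rule cf_normal_approx[OF K pq1(2)[OF elim] pq1(1)[OF elim] elim])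
    qed
  qed
qed

end

section \<open>Central limit theorem for weakly dependent sequences\<close>

definition truncate_at :: "real \<Rightarrow> real \<Rightarrow> real" where
  "truncate_at K y = max (- K) (min K y)"

lemma truncate_at_lipschitz: "1-lipschitz_on UNIV (truncate_at K)"
  and minus_truncate_at_lipschitz: "1-lipschitz_on UNIV (\<lambda>y. y - truncate_at K y)" if "0 \<le> K"
  using that by (auto intro!: lipschitz_onI simp: dist_real_def truncate_at_def max_def min_def)

lemma lipschitz_on_minus_const:
  "1-lipschitz_on UNIV f \<Longrightarrow> 1-lipschitz_on UNIV (\<lambda>y::real. f y - c :: real)"
  by (simp add: lipschitz_on_def dist_real_def)

context weakly_dependent
begin

lemma Y_integrable: "integrable M (Y i)"
  by (rule square_integrable_imp_integrable[OF _ Y_square_integrable]) simp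

lemma transform_centred:
  assumes f: "1-lipschitz_on UNIV f" and c: "c = expectation (\<lambda>x. f (Y 0 x))"
  shows "weakly_dependent_transform M Y r (\<lambda>y. f y - c)"
proof unfold_locales
  show "1-lipschitz_on UNIV (\<lambda>y. f y - c)" by (rule lipschitz_on_minus_const[OF f])
  have [measurable]: "f \<in> borel_measurable borel" by (rule lipschitz_on_borel_measurable[OF f])
  have "integrable M (\<lambda>x. f (Y 0 x))"
    by (rule square_integrable_imp_integrable[OF _ lipschitz_square_integrable[OF f]])
      (simp_all add: Y_square)
  then show "expectation (\<lambda>x. f (Y 0 x) - c) = 0" by (simp add: c prob_space)
qed

lemma truncation_error_tendsto_zero:
  "(\<lambda>k. L2_norm M (\<lambda>x. Y 0 x - truncate_at (real k) (Y 0 x))) \<longlonglongrightarrow> 0"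
proof -
  have [measurable]: "truncate_at (real k) \<in> borel_measurable borel" for k
    by (rule lipschitz_on_borel_measurable[OF truncate_at_lipschitz]) simp
  have "(\<lambda>k. \<integral>x. (Y 0 x - truncate_at (real k) (Y 0 x))\<^sup>2 \<partial>M) \<longlonglongrightarrow> (\<integral>x. 0 \<partial>M)"
  proof (rule integral_dominated_convergence[where w="\<lambda>x. (Y 0 x)\<^sup>2"])
    show "AE x in M. (\<lambda>k. (Y 0 x - truncate_at (real k) (Y 0 x))\<^sup>2) \<longlonglongrightarrow> 0"
    proof (rule AE_I2)
      fix x
      obtain N :: nat where N: "\<bar>Y 0 x\<bar> \<le> real N" using real_arch_simple by blast
      have "\<forall>\<^sub>F k in sequentially. (Y 0 x - truncate_at (real k) (Y 0 x))\<^sup>2 = 0"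
        using eventually_ge_at_top[of N] by eventually_elim (use N in \<open>auto simp: truncate_at_def\<close>)
      then show "(\<lambda>k. (Y 0 x - truncate_at (real k) (Y 0 x))\<^sup>2) \<longlonglongrightarrow> 0" by (rule tendsto_eventually)
    qed
    show "AE x in M. norm ((Y 0 x - truncate_at (real k) (Y 0 x))\<^sup>2) \<le> (Y 0 x)\<^sup>2" for k
    proof (rule AE_I2)
      fix x
      have "\<bar>Y 0 x - truncate_at (real k) (Y 0 x)\<bar> \<le> \<bar>Y 0 x\<bar>" by (auto simp: truncate_at_def)
      then show "norm ((Y 0 x - truncate_at (real k) (Y 0 x))\<^sup>2) \<le> (Y 0 x)\<^sup>2"
        by (simp add: abs_le_square_iff)
    qed
  qed (use Y_square in auto)
  then have "(\<lambda>k. sqrt (\<integral>x. (Y 0 x - truncate_at (real k) (Y 0 x))\<^sup>2 \<partial>M)) \<longlonglongrightarrow> sqrt (\<integral>x. 0 \<partial>M)"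
    by (rule tendsto_real_sqrt)
  then show ?thesis by (simp add: L2_norm_def)
qed

text \<open>Truncation at level \<open>k\<close> splits \<open>Y i - m\<close> into two centred 1-Lipschitz functions of \<open>Y i\<close>, a bounded
part (\<open>A\<close> below) and a remainder (\<open>B\<close> below). The remainder contributes at most \<open>e k * sqrt n\<close> to the
\<open>L\<^sup>2\<close> norm of the sum, uniformly in \<open>n\<close>, and this affects both the characteristic function and the
variance in the Gaussian factor only by an amount that vanishes with \<open>e k\<close>.\<close>

lemma cf_normal_limit:
  defines "m \<equiv> expectation (Y 0)"
  defines "T \<equiv> \<lambda>n x. \<Sum>i<n. (Y i x - m)"
  shows "(\<lambda>n. (\<integral>x. iexp (t / sqrt (real n) * T n x) \<partial>M)
    - exp (- complex_of_real (t\<^sup>2 / 2 * ((\<integral>x. (T n x)\<^sup>2 \<partial>M) / real n)))) \<longlonglongrightarrow> 0"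
proof -
  have T1: "(1::real)-lipschitz_on UNIV (\<lambda>y::real. y)" by (simp add: lipschitz_on_def)
  interpret F: weakly_dependent_transform M Y r "\<lambda>y. y - m"
    by (rule transform_centred[OF T1]) (simp add: m_def)
  define c where "c k = expectation (\<lambda>x. truncate_at (real k) (Y 0 x))" for k
  define d where "d k = expectation (\<lambda>x. Y 0 x - truncate_at (real k) (Y 0 x))" for k
  interpret A: weakly_dependent_transform M Y r "\<lambda>y. truncate_at (real k) y - c k" for k
    by (rule transform_centred[OF truncate_at_lipschitz]) (simp_all add: c_def)
  interpret B: weakly_dependent_transform M Y r "\<lambda>y. (y - truncate_at (real k) y) - d k" for k
    by (rule transform_centred[OF minus_truncate_at_lipschitz]) (simp_all add: d_def)
  have truncate_at_bound: "\<bar>truncate_at (real k) y\<bar> \<le> real k" for k y by (auto simp: truncate_at_def)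
  have [measurable]: "truncate_at (real k) \<in> borel_measurable borel" for k
    by (rule lipschitz_on_borel_measurable[OF truncate_at_lipschitz]) simp
  have int_truncate: "integrable M (\<lambda>x. truncate_at (real k) (Y 0 x))" for k
    by (rule integrable_const_bound[of _ "real k"]) (use truncate_at_bound in auto)
  have m: "m = c k + d k" for k
    unfolding m_def c_def d_def using int_truncate[of k] Y_integrable[of 0] by simp
  have TF: "T n = F.S {..<n}" for n by (simp add: T_def F.S_def fun_eq_iff)
  have split: "F.S I x - A.S k I x = B.S k I x" for I k x
    unfolding F.S_def A.S_def B.S_def sum_subtractf[symmetric] using m[of k] by (intro sum.cong) auto
  define e where "e k = sqrt (B.C k)" for k
  have \<sigma>0: "(\<lambda>k. B.\<sigma> k) \<longlonglongrightarrow> 0"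
  proof (rule tendsto_sandwich[OF _ _ tendsto_const truncation_error_tendsto_zero])
    show "\<forall>\<^sub>F k in sequentially. 0 \<le> B.\<sigma> k" by (simp add: B.\<sigma>_nonneg)
    have "B.\<sigma> k \<le> L2_norm M (\<lambda>x. Y 0 x - truncate_at (real k) (Y 0 x))" for k
    proof -
      have sq: "integrable M (\<lambda>x. (Y 0 x - truncate_at (real k) (Y 0 x))\<^sup>2)"
        by (rule lipschitz_square_integrable[OF minus_truncate_at_lipschitz]) (use Y_square in auto)
      have "variance (\<lambda>x. Y 0 x - truncate_at (real k) (Y 0 x)) \<le> (\<integral>x. (Y 0 x - truncate_at (real k) (Y 0 x))\<^sup>2 \<partial>M)"
        using int_truncate[of k] Y_integrable[of 0] by (subst variance_eq) (auto intro: sq)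
      then show ?thesis unfolding B.\<sigma>_def L2_norm_def d_def[symmetric] by simp
    qed
    then show "\<forall>\<^sub>F k in sequentially. B.\<sigma> k \<le> L2_norm M (\<lambda>x. Y 0 x - truncate_at (real k) (Y 0 x))" by simp
  qed
  have e0: "e \<longlonglongrightarrow> 0"
  proof -
    have "(\<lambda>k. sqrt (B.\<sigma> k * (B.\<sigma> k + 2 * tail 1))) \<longlonglongrightarrow> sqrt (0 * (0 + 2 * tail 1))"
      by (intro tendsto_intros \<sigma>0)
    then show ?thesis by (simp add: e_def[abs_def] B.C_def)
  qed
  have D: "L2_norm M (\<lambda>x. F.S {..<n} x - A.S k {..<n} x) \<le> sqrt (real n) * e k" for n k
    unfolding split using B.L2_norm_S_le[of "{..<n}" k]
    by (simp add: e_def real_sqrt_mult mult.commute)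
  have close: "cmod ((F.cf (t / sqrt (real n)) {..<n} - exp (- complex_of_real (t\<^sup>2 / 2 * ((\<integral>x. (F.S {..<n} x)\<^sup>2 \<partial>M) / real n))))
      - (A.cf k (t / sqrt (real n)) {..<n} - exp (- complex_of_real (t\<^sup>2 / 2 * ((\<integral>x. (A.S k {..<n} x)\<^sup>2 \<partial>M) / real n)))))
    \<le> \<bar>t\<bar> * e k + t\<^sup>2 / 2 * (e k * (2 * sqrt F.C + e k))" if n: "1 \<le> n" for n k
  proof -
    define V where "V = (\<integral>x. (F.S {..<n} x)\<^sup>2 \<partial>M)"
    define V' where "V' = (\<integral>x. (A.S k {..<n} x)\<^sup>2 \<partial>M)"
    have n0: "0 < real n" using n by simp
    have "cmod (F.cf (t / sqrt (real n)) {..<n} - A.cf k (t / sqrt (real n)) {..<n})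
        \<le> \<bar>t / sqrt (real n)\<bar> * L2_norm M (\<lambda>x. F.S {..<n} x - A.S k {..<n} x)"
      unfolding F.cf_def A.cf_def
      by (rule norm_expectation_iexp_diff_le) (simp_all add: F.S_square_integrable A.S_square_integrable)
    also have "\<dots> \<le> \<bar>t / sqrt (real n)\<bar> * (sqrt (real n) * e k)"
      by (rule mult_left_mono[OF D]) simp
    also have "\<dots> = \<bar>t\<bar> * e k" using n0 by simp
    finally have 1: "cmod (F.cf (t / sqrt (real n)) {..<n} - A.cf k (t / sqrt (real n)) {..<n}) \<le> \<bar>t\<bar> * e k" .
    have V0: "0 \<le> V" "0 \<le> V'" by (simp_all add: V_def V'_def)
    have ek: "0 \<le> e k" by (simp add: e_def B.C_nonneg)
    have "\<bar>V - V'\<bar> \<le> L2_norm M (\<lambda>x. F.S {..<n} x - A.S k {..<n} x)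
        * (2 * L2_norm M (F.S {..<n}) + L2_norm M (\<lambda>x. F.S {..<n} x - A.S k {..<n} x))"
      unfolding V_def V'_def
      by (rule diff_L2_norm_squares) (simp_all add: F.S_square_integrable A.S_square_integrable)
    also have "\<dots> \<le> (sqrt (real n) * e k) * (2 * (sqrt (real n) * sqrt F.C) + sqrt (real n) * e k)"
      using D[of n k] F.L2_norm_S_le[of "{..<n}"] ek
      by (intro mult_mono add_mono mult_left_mono) (auto simp: L2_norm_nonneg F.C_nonneg real_sqrt_mult mult.commute)
    also have "\<dots> = (sqrt (real n) * sqrt (real n)) * (e k * (2 * sqrt F.C + e k))"
      by (simp only: distrib_left mult_ac)
    finally have VV: "\<bar>V - V'\<bar> / real n \<le> e k * (2 * sqrt F.C + e k)"
      using n0 by (simp add: divide_le_eq mult.commute)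
    have "cmod (exp (- complex_of_real (t\<^sup>2 / 2 * (V / real n))) - exp (- complex_of_real (t\<^sup>2 / 2 * (V' / real n))))
      = \<bar>exp (- (t\<^sup>2 / 2 * (V / real n))) - exp (- (t\<^sup>2 / 2 * (V' / real n)))\<bar>"
      by (simp only: of_real_minus[symmetric] exp_of_real of_real_diff[symmetric] norm_of_real)
    also have "\<dots> \<le> \<bar>t\<^sup>2 / 2 * (V / real n) - t\<^sup>2 / 2 * (V' / real n)\<bar>"
      using V0 by (intro abs_exp_minus_diff_le) auto
    also have "\<dots> = t\<^sup>2 / 2 * (\<bar>V - V'\<bar> / real n)"
    proof -
      have "t\<^sup>2 / 2 * (V / real n) - t\<^sup>2 / 2 * (V' / real n) = t\<^sup>2 / 2 * ((V - V') / real n)"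
        by (simp add: right_diff_distrib diff_divide_distrib)
      then show ?thesis using n0 by (simp add: abs_mult)
    qed
    also have "\<dots> \<le> t\<^sup>2 / 2 * (e k * (2 * sqrt F.C + e k))"
      by (rule mult_left_mono[OF VV]) simp
    finally have 2: "cmod (exp (- complex_of_real (t\<^sup>2 / 2 * (V / real n))) - exp (- complex_of_real (t\<^sup>2 / 2 * (V' / real n))))
      \<le> t\<^sup>2 / 2 * (e k * (2 * sqrt F.C + e k))" .
    have "cmod ((a - b) - (a' - b')) \<le> cmod (a - a') + cmod (b - b')" for a b a' b' :: complex
      using norm_triangle_ineq4[of "a - a'" "b - b'"] by (simp add: algebra_simps)
    from order_trans[OF this add_mono[OF 1 2]] show ?thesis unfolding V_def V'_def .
  qed
  have E0: "(\<lambda>k. \<bar>t\<bar> * e k + t\<^sup>2 / 2 * (e k * (2 * sqrt F.C + e k))) \<longlonglongrightarrow> 0"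
  proof -
    have "(\<lambda>k. \<bar>t\<bar> * e k + t\<^sup>2 / 2 * (e k * (2 * sqrt F.C + e k)))
        \<longlonglongrightarrow> \<bar>t\<bar> * 0 + t\<^sup>2 / 2 * (0 * (2 * sqrt F.C + 0))"
      by (intro tendsto_intros e0)
    then show ?thesis by simp
  qed
  have lim: "(\<lambda>n. A.cf k (t / sqrt (real n)) {..<n}
      - exp (- complex_of_real (t\<^sup>2 / 2 * ((\<integral>x. (A.S k {..<n} x)\<^sup>2 \<partial>M) / real n)))) \<longlonglongrightarrow> 0" for k
  proof (rule A.cf_normal_limit_bounded)
    show "\<bar>truncate_at (real k) u - c k\<bar> \<le> real k + \<bar>c k\<bar>" for u
      using truncate_at_bound[of k u] by linarith
  qed
  have "(\<lambda>n. F.cf (t / sqrt (real n)) {..<n}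
      - exp (- complex_of_real (t\<^sup>2 / 2 * ((\<integral>x. (F.S {..<n} x)\<^sup>2 \<partial>M) / real n)))) \<longlonglongrightarrow> 0" (is "?f \<longlonglongrightarrow> 0")
  proof (rule tendstoI)
    fix \<epsilon> :: real assume \<epsilon>: "0 < \<epsilon>"
    obtain k where k: "\<bar>t\<bar> * e k + t\<^sup>2 / 2 * (e k * (2 * sqrt F.C + e k)) < \<epsilon> / 2"
      using order_tendstoD(2)[OF E0, of "\<epsilon> / 2"] \<epsilon> by (auto simp: eventually_sequentially)
    have "\<forall>\<^sub>F n in sequentially. dist (A.cf k (t / sqrt (real n)) {..<n}
      - exp (- complex_of_real (t\<^sup>2 / 2 * ((\<integral>x. (A.S k {..<n} x)\<^sup>2 \<partial>M) / real n)))) 0 < \<epsilon> / 2"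
      by (rule tendstoD[OF lim]) (use \<epsilon> in simp)
    with eventually_ge_at_top[of 1] show "\<forall>\<^sub>F n in sequentially. dist (?f n) 0 < \<epsilon>"
    proof eventually_elim
      case (elim n)
      have "cmod x < \<epsilon>" if "cmod (x - y) \<le> E" "E < \<epsilon> / 2" "dist y 0 < \<epsilon> / 2" for x y :: complex and E
        using norm_triangle_sub[of x y] that by simp
      from this[OF close[OF elim(1)] k elim(2)] show ?case by simp
    qed
  qed
  then show ?thesis unfolding TF F.cf_def .
qed

end

lemma char_normal:
  assumes s: "0 < s"
  shows "char (density lborel (normal_density 0 s)) t = complex_of_real (exp (- (t\<^sup>2 / 2 * s\<^sup>2)))"
    and "real_distribution (density lborel (normal_density 0 s))"
proof -
  interpret N: prob_space std_normal_distribution by (rule prob_space_normal_density) simp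
  have "distributed std_normal_distribution lborel (\<lambda>x. x) std_normal_density"
    by (simp add: distributed_def distr_id2)
  then have "distributed std_normal_distribution lborel (\<lambda>x. 0 + s * x) (normal_density (0 + s * 0) (\<bar>s\<bar> * 1))"
    by (rule N.normal_density_affine) (use s in auto)
  then have eq: "density lborel (normal_density 0 s) = distr std_normal_distribution lborel (\<lambda>x. s * x)"
    using s by (simp add: distributed_def)
  have "char (density lborel (normal_density 0 s)) t = (CLINT x|std_normal_distribution. iexp (t * (s * x)))"
    unfolding eq char_def by (subst integral_distr) auto
  also have "\<dots> = char std_normal_distribution (t * s)"
    by (simp add: char_def mult.assoc)
  finally show "char (density lborel (normal_density 0 s)) t = complex_of_real (exp (- (t\<^sup>2 / 2 * s\<^sup>2)))"
    by (simp add: char_std_normal_distribution power_mult_distrib)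
  show "real_distribution (density lborel (normal_density 0 s))"
    using prob_space_normal_density[OF s] by (simp add: real_distribution_def real_distribution_axioms_def)
qed

theorem (in weakly_dependent) clt:
  defines "m \<equiv> expectation (Y 0)"
  assumes var: "(\<lambda>n. (\<integral>x. (\<Sum>i<n. Y i x - m)\<^sup>2 \<partial>M) / real n) \<longlonglongrightarrow> a" and a: "0 < a"
  shows "weak_conv_m (\<lambda>n. distr M borel (\<lambda>x. sqrt (real n) * ((\<Sum>i<n. Y i x) / real n - m)))
    (density lborel (normal_density 0 (sqrt a)))"
proof (rule levy_continuity)
  show "real_distribution (density lborel (normal_density 0 (sqrt a)))"
    by (rule char_normal(2)) (use a in simp)
  show "real_distribution (distr M borel (\<lambda>x. sqrt (real n) * ((\<Sum>i<n. Y i x) / real n - m)))" for n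
    by (rule real_distribution_distr) simp
  fix t
  have scale: "sqrt (real n) * ((\<Sum>i<n. Y i x) / real n - m) = (\<Sum>i<n. Y i x - m) / sqrt (real n)" for n x
  proof (cases "n = 0")
    case False
    then have "(\<Sum>i<n. Y i x) / real n - m = (\<Sum>i<n. Y i x - m) / real n"
      by (simp add: sum_subtractf diff_divide_distrib)
    then show ?thesis by (metis (no_types) divide_divide_eq_right mult.commute mult_divide_mult_cancel_left_if of_nat_0_le_iff real_div_sqrt times_divide_eq_right)
  qed simp
  let ?E = "\<lambda>n. exp (- complex_of_real (t\<^sup>2 / 2 * ((\<integral>x. (\<Sum>i<n. Y i x - m)\<^sup>2 \<partial>M) / real n)))"
  have "char (distr M borel (\<lambda>x. sqrt (real n) * ((\<Sum>i<n. Y i x) / real n - m))) t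
      = (\<integral>x. iexp (t / sqrt (real n) * (\<Sum>i<n. Y i x - m)) \<partial>M)" for n
    unfolding char_def scale by (subst integral_distr) auto
  moreover have "(\<lambda>n. ((\<integral>x. iexp (t / sqrt (real n) * (\<Sum>i<n. Y i x - m)) \<partial>M) - ?E n) + ?E n)
      \<longlonglongrightarrow> 0 + exp (- complex_of_real (t\<^sup>2 / 2 * a))"
    unfolding m_def by (intro tendsto_add cf_normal_limit) (intro tendsto_intros var[unfolded m_def])
  ultimately show "(\<lambda>n. char (distr M borel (\<lambda>x. sqrt (real n) * ((\<Sum>i<n. Y i x) / real n - m))) t)
      \<longlonglongrightarrow> char (density lborel (normal_density 0 (sqrt a))) t"
    using a by (simp add: char_normal exp_of_real[symmetric])
qed

section \<open>A strong law under finite range of dependence\<close>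

context prob_space
begin

lemma sum_square_expectation_le_of_finite_range:
  fixes W :: "nat \<Rightarrow> 'a \<Rightarrow> real"
  assumes [measurable]: "\<And>i. W i \<in> borel_measurable M" and B: "\<And>i x. x \<in> space M \<Longrightarrow> \<bar>W i x\<bar> \<le> B"
    and uncorrelated: "\<And>i k. i + h \<le> k \<Longrightarrow> expectation (\<lambda>x. W i x * W k x) = 0"
  shows "expectation (\<lambda>x. (\<Sum>i<n. W i x)\<^sup>2) \<le> real n * (real (2 * h + 1) * B\<^sup>2)"
proof -
  have bound: "\<bar>W i x * W k x\<bar> \<le> B\<^sup>2" if "x \<in> space M" for i k x
    using mult_mono[OF B[OF that, of i] B[OF that, of k]] B[OF that, of i]
    by (simp add: abs_mult power2_eq_square)
  have int: "integrable M (\<lambda>x. W i x * W k x)" for i k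
    using bound by (intro integrable_const_bound[of _ "B\<^sup>2"]) auto
  have cov: "\<bar>expectation (\<lambda>x. W i x * W k x)\<bar> \<le> (if k \<in> {i - h..i + h} then B\<^sup>2 else 0)" for i k
  proof (cases "k \<in> {i - h..i + h}")
    case True
    have "\<bar>expectation (\<lambda>x. W i x * W k x)\<bar> \<le> expectation (\<lambda>x. \<bar>W i x * W k x\<bar>)"
      by (rule integral_abs_bound)
    also have "\<dots> \<le> expectation (\<lambda>x. B\<^sup>2)"
      using int bound by (intro integral_mono) auto
    finally show ?thesis using True by (simp add: prob_space)
  next
    case False
    then have "i + h \<le> k \<or> k + h \<le> i" by auto
    then show ?thesis using False uncorrelated[of i k] uncorrelated[of k i] by (auto simp: mult.commute)
  qed
  have "expectation (\<lambda>x. (\<Sum>i<n. W i x)\<^sup>2) = (\<Sum>i<n. \<Sum>k<n. expectation (\<lambda>x. W i x * W k x))"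
    using int by (simp add: power2_eq_square sum_product)
  also have "\<dots> \<le> (\<Sum>i<n. \<Sum>k<n. if k \<in> {i - h..i + h} then B\<^sup>2 else 0)"
    by (intro sum_mono order_trans[OF abs_ge_self cov])
  also have "\<dots> \<le> (\<Sum>i<n. real (2 * h + 1) * B\<^sup>2)"
  proof (rule sum_mono)
    fix i
    have "(\<Sum>k<n. if k \<in> {i - h..i + h} then B\<^sup>2 else 0) = real (card ({..<n} \<inter> {i - h..i + h})) * B\<^sup>2"
      by (subst sum.inter_restrict[symmetric]) simp_all
    also have "card ({..<n} \<inter> {i - h..i + h}) \<le> card {i - h..i + h}"
      by (rule card_mono) auto
    then have "real (card ({..<n} \<inter> {i - h..i + h})) * B\<^sup>2 \<le> real (2 * h + 1) * B\<^sup>2"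
      by (intro mult_right_mono) auto
    finally show "(\<Sum>k<n. if k \<in> {i - h..i + h} then B\<^sup>2 else 0) \<le> real (2 * h + 1) * B\<^sup>2" .
  qed
  finally show ?thesis by simp
qed

lemma AE_tendsto_zero_of_summable_squares:
  fixes A :: "nat \<Rightarrow> 'a \<Rightarrow> real"
  assumes [measurable]: "\<And>j. A j \<in> borel_measurable M" and int: "\<And>j. integrable M (\<lambda>x. (A j x)\<^sup>2)"
    and s: "summable (\<lambda>j. expectation (\<lambda>x. (A j x)\<^sup>2))"
  shows "AE x in M. (\<lambda>j. A j x) \<longlonglongrightarrow> 0"
proof -
  have "(\<integral>\<^sup>+x. (\<Sum>j. ennreal ((A j x)\<^sup>2)) \<partial>M) = (\<Sum>j. ennreal (expectation (\<lambda>x. (A j x)\<^sup>2)))"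
    using int by (subst nn_integral_suminf) (auto simp: nn_integral_eq_integral)
  also have "\<dots> \<noteq> \<infinity>" using s by (simp add: suminf_ennreal2)
  finally have "AE x in M. (\<Sum>j. ennreal ((A j x)\<^sup>2)) \<noteq> \<infinity>"
    by (intro nn_integral_PInf_AE) auto
  then show ?thesis
  proof eventually_elim
    case (elim x)
    then have "summable (\<lambda>j. (A j x)\<^sup>2)" by (intro summable_suminf_not_top) auto
    then have "(\<lambda>j. sqrt ((A j x)\<^sup>2)) \<longlonglongrightarrow> sqrt 0"
      by (intro tendsto_real_sqrt summable_LIMSEQ_zero)
    then show ?case by (simp add: tendsto_rabs_zero_iff)
  qed
qed

text \<open>Along the squares \<open>n = j\<^sup>2\<close> the second moments of the averages are of the order \<open>1 / j\<^sup>2\<close> and hence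
summable. Between consecutive squares there are only \<open>O(sqrt n)\<close> terms, which for bounded variables change
the average by \<open>O(1 / sqrt n)\<close>.\<close>

lemma strong_law_finite_range:
  fixes W :: "nat \<Rightarrow> 'a \<Rightarrow> real"
  assumes W[measurable]: "\<And>i. W i \<in> borel_measurable M" and B: "\<And>i x. x \<in> space M \<Longrightarrow> \<bar>W i x\<bar> \<le> B"
    and uncorrelated: "\<And>i k. i + h \<le> k \<Longrightarrow> expectation (\<lambda>x. W i x * W k x) = 0"
  shows "AE x in M. (\<lambda>n. (\<Sum>i<n. W i x) / real n) \<longlonglongrightarrow> 0"
proof -
  define A where "A n x = (\<Sum>i<n. W i x) / real n" for n x
  have [measurable]: "A n \<in> borel_measurable M" for n unfolding A_def[abs_def] by measurable
  let ?c = "real (2 * h + 1) * B\<^sup>2"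
  have sum_bound: "\<bar>\<Sum>i\<in>I. W i x\<bar> \<le> real (card I) * B" if "x \<in> space M" for I x
    using sum_bounded_above[of I "\<lambda>i. \<bar>W i x\<bar>" B] B[OF that] by (intro order_trans[OF sum_abs]) auto
  have "AE x in M. (\<lambda>j. A (j\<^sup>2) x) \<longlonglongrightarrow> 0"
  proof (rule AE_tendsto_zero_of_summable_squares)
    have "(A n x)\<^sup>2 \<le> B\<^sup>2" if "x \<in> space M" for n x
    proof (cases "n = 0")
      case False
      then have "\<bar>A n x\<bar> \<le> \<bar>B\<bar>"
        using sum_bound[OF that, of "{..<n}"] order_trans[OF abs_ge_zero B[OF that, of 0]]
        by (simp add: A_def divide_le_eq mult.commute)
      then show ?thesis by (simp add: abs_le_square_iff)
    qed (simp add: A_def)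
    then show int: "integrable M (\<lambda>x. (A (j\<^sup>2) x)\<^sup>2)" for j
      by (intro integrable_const_bound[of _ "B\<^sup>2"]) auto
    show "summable (\<lambda>j. expectation (\<lambda>x. (A (j\<^sup>2) x)\<^sup>2))"
    proof (rule summable_comparison_test[OF exI[of _ 1]])
      show "summable (\<lambda>j::nat. ?c * (1 / real j ^ 2))"
        by (intro summable_mult inverse_power_summable[of 2, simplified inverse_eq_divide]) simp
      show "\<forall>j\<ge>1. norm (expectation (\<lambda>x. (A (j\<^sup>2) x)\<^sup>2)) \<le> ?c * (1 / real j ^ 2)"
      proof (intro allI impI)
        fix j :: nat assume j: "1 \<le> j"
        define N where "N = real (j\<^sup>2)"
        have N: "0 < N" using j by (simp add: N_def)
        have "expectation (\<lambda>x. (A (j\<^sup>2) x)\<^sup>2) = expectation (\<lambda>x. (\<Sum>i<j\<^sup>2. W i x)\<^sup>2) / N\<^sup>2"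
          by (simp add: A_def power_divide N_def)
        also have "\<dots> \<le> (N * ?c) / N\<^sup>2"
          unfolding N_def using sum_square_expectation_le_of_finite_range[where W=W and h=h and B=B, OF W B uncorrelated]
          by (intro divide_right_mono zero_le_power2) blast
        also have "\<dots> = ?c * (1 / N)" using N by (simp add: power2_eq_square)
        finally show "norm (expectation (\<lambda>x. (A (j\<^sup>2) x)\<^sup>2)) \<le> ?c * (1 / real j ^ 2)"
          by (simp add: N_def)
      qed
    qed
  qed simp
  with AE_space show ?thesis
  proof eventually_elim
    case (elim x)
    note x = elim(1)
    \<comment> \<open>\<open>(k n)\<^sup>2\<close> is the largest square up to \<open>n\<close>.\<close>
    define k where "k n = nat \<lfloor>sqrt (real n)\<rfloor>" for n :: nat
    have B0: "0 \<le> B" using B[OF elim(1), of 0] by linarith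
    have k: "real (k n) \<le> sqrt n" "sqrt n < real (k n) + 1" for n
    proof -
      have "real (k n) = of_int \<lfloor>sqrt (real n)\<rfloor>" by (simp add: k_def)
      then show "real (k n) \<le> sqrt n" "sqrt n < real (k n) + 1"
        using floor_correct[of "sqrt (real n)"] by linarith+
    qed
    have k_top: "filterlim k at_top sequentially"
    proof -
      have "filterlim (\<lambda>n. real (k n)) at_top sequentially"
      proof (rule filterlim_at_top_mono)
        show "filterlim (\<lambda>n. sqrt (real n) - 1) at_top sequentially" by real_asymp
        show "\<forall>\<^sub>F n in sequentially. sqrt (real n) - 1 \<le> real (k n)"
          using k(2) by (intro always_eventually allI) (simp add: less_imp_le diff_le_eq)
      qed
      then show ?thesis unfolding filterlim_sequentially_iff_filterlim_real .
    qed
    have lim: "(\<lambda>n. \<bar>A ((k n)\<^sup>2) x\<bar> + 3 * B / sqrt n) \<longlonglongrightarrow> 0 + 0"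
      by (intro tendsto_add tendsto_rabs_zero filterlim_compose[OF elim(2) k_top]) real_asymp
    show "(\<lambda>n. (\<Sum>i<n. W i x) / real n) \<longlonglongrightarrow> 0"
    proof (rule Lim_null_comparison[rotated])
      show "(\<lambda>n. \<bar>A ((k n)\<^sup>2) x\<bar> + 3 * B / sqrt n) \<longlonglongrightarrow> 0" using lim by simp
      show "\<forall>\<^sub>F n in sequentially. norm ((\<Sum>i<n. W i x) / real n) \<le> \<bar>A ((k n)\<^sup>2) x\<bar> + 3 * B / sqrt n"
        using eventually_gt_at_top[of 0]
      proof eventually_elim
        case (elim n)
        define K where "K = (k n)\<^sup>2"
        define s where "s = sqrt (real n)"
        have s: "0 < s" "real n = s * s" using elim by (simp_all add: s_def)
        have ks: "real (k n) \<le> s" "s \<le> real (k n) + 1"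
          using k(1)[of n] k(2)[of n] by (simp_all add: s_def)
        have Kn: "real K \<le> real n"
        proof -
          have "real (k n) * real (k n) \<le> s * s"
            using ks(1) s(1) by (intro mult_mono) auto
          then show ?thesis by (simp add: K_def power2_eq_square s(2))
        qed
        then have "K \<le> n" by simp
        then have split: "(\<Sum>i<n. W i x) = (\<Sum>i<K. W i x) + (\<Sum>i\<in>{K..<n}. W i x)"
          using sum.union_disjoint[of "{..<K}" "{K..<n}" "\<lambda>i. W i x"] by (simp add: ivl_disj_un ivl_disj_int)
        have "real n \<le> (real (k n) + 1) * (real (k n) + 1)"
          unfolding s(2) using ks(2) s(1) by (intro mult_mono) auto
        then have gap: "real n - real K \<le> 2 * s + 1"
          using ks(1) by (simp add: K_def power2_eq_square algebra_simps)
        have s1: "1 \<le> s" using elim by (simp add: s_def)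
        have "\<bar>\<Sum>i<K. W i x\<bar> = real K * \<bar>A K x\<bar>" by (simp add: A_def)
        also have "\<dots> \<le> real n * \<bar>A K x\<bar>" using Kn by (intro mult_right_mono) auto
        finally have 1: "\<bar>\<Sum>i<K. W i x\<bar> \<le> real n * \<bar>A K x\<bar>" .
        have "\<bar>\<Sum>i\<in>{K..<n}. W i x\<bar> \<le> (real n - real K) * B"
          using sum_bound[OF x, of "{K..<n}"] \<open>K \<le> n\<close> by (simp add: of_nat_diff)
        also have "\<dots> \<le> (3 * s) * B" using gap s1 B0 by (intro mult_right_mono) auto
        finally have "\<bar>\<Sum>i<n. W i x\<bar> \<le> real n * \<bar>A K x\<bar> + (3 * s) * B"
          using 1 unfolding split by linarith
        then have "\<bar>\<Sum>i<n. W i x\<bar> / real n \<le> (real n * \<bar>A K x\<bar> + (3 * s) * B) / real n"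
          by (rule divide_right_mono) simp
        also have "\<dots> = \<bar>A K x\<bar> + 3 * B / s"
          using s by (simp add: add_divide_distrib)
        finally show ?case by (simp add: K_def s_def)
      qed
    qed
  qed
qed

end

section \<open>The quenched variance\<close>

lemma sum_symmetric_eq_diagonal_sums:
  fixes c :: "nat \<Rightarrow> nat \<Rightarrow> real"
  assumes "\<And>i k. c i k = c k i"
  shows "(\<Sum>i<n. \<Sum>k<n. c i k) = (\<Sum>i<n. c i i) + 2 * (\<Sum>h<n. \<Sum>i<n - Suc h. c i (i + Suc h))"
proof (induction n)
  case (Suc n)
  have "(\<Sum>h<Suc n. \<Sum>i<Suc n - Suc h. c i (i + Suc h)) = (\<Sum>h<n. \<Sum>i<n - h. c i (i + Suc h))"
    by simp
  also have "\<dots> = (\<Sum>h<n. (\<Sum>i<n - Suc h. c i (i + Suc h)) + c (n - Suc h) n)"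
  proof (rule sum.cong[OF refl])
    fix h assume "h \<in> {..<n}"
    then have eqs: "n - h = Suc (n - Suc h)" "n - Suc h + Suc h = n" by auto
    then show "(\<Sum>i<n - h. c i (i + Suc h)) = (\<Sum>i<n - Suc h. c i (i + Suc h)) + c (n - Suc h) n"
      by (simp only: eqs sum.lessThan_Suc)
  qed
  also have "\<dots> = (\<Sum>h<n. \<Sum>i<n - Suc h. c i (i + Suc h)) + (\<Sum>i<n. c i n)"
    using sum.nat_diff_reindex[of "\<lambda>i. c i n" n] by (simp add: sum.distrib)
  finally have "(\<Sum>h<Suc n. \<Sum>i<Suc n - Suc h. c i (i + Suc h)) = \<dots>" .
  moreover have "(\<Sum>i<Suc n. \<Sum>k<Suc n. c i k) = (\<Sum>i<n. \<Sum>k<n. c i k) + 2 * (\<Sum>i<n. c i n) + c n n"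
    using assms by (simp add: sum.distrib)
  ultimately show ?case using Suc.IH by (simp only: sum.lessThan_Suc) (simp only: distrib_left)
qed simp

lemma measurable_add_nat:
  assumes f: "f \<in> measurable M (count_space UNIV)" and g: "g \<in> measurable M (count_space UNIV)"
  shows "(\<lambda>x. f x + g x :: nat) \<in> measurable M (count_space UNIV)"
  by (rule measurable_compose_countable[OF _ f]) (rule measurable_compose[OF g measurable_count_space])

lemma measurable_sum_nat:
  assumes "\<And>i. i \<in> I \<Longrightarrow> f i \<in> measurable M (count_space UNIV)"
  shows "(\<lambda>x. \<Sum>i\<in>I. f i x :: nat) \<in> measurable M (count_space UNIV)"
  using assms
  by (induction I rule: infinite_finite_induct) (simp_all add: measurable_add_nat)

text \<open>If \<open>\<gamma>\<close> is the autocovariance function of \<open>\<xi>\<close>, this is the variance of \<open>\<xi> (S\<^sub>1) + \<dots> + \<xi> (S\<^sub>n)\<close> for the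
given trajectory, with the pairs of times grouped by their lag \<open>Suc h\<close>. The inner sum of steps is the
distance covered by the walk between the times \<open>i + 1\<close> and \<open>i + 1 + Suc h\<close>.\<close>

definition walk_gap_sum :: "(nat \<Rightarrow> real) \<Rightarrow> (nat \<Rightarrow> 'a \<Rightarrow> nat) \<Rightarrow> nat \<Rightarrow> 'a \<Rightarrow> real" where
  "walk_gap_sum \<gamma> X n \<omega> = real n * \<gamma> 0
     + 2 * (\<Sum>h<n. \<Sum>i<n - Suc h. \<gamma> (\<Sum>j\<in>{i + 2..i + Suc h + 1}. X j \<omega>))"

text \<open>For a fixed lag, the summands depend on disjoint sets of steps as soon as their starting times differ
by at least the lag, so the strong law applies to them. As the walk covers at least one unit per step, the
summands of lag \<open>h\<close> are bounded by \<open>b h\<close>, whence Tannery's theorem permits summing over all lags.\<close>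

lemma (in prob_space) walk_gap_sum_concentration:
  fixes X :: "nat \<Rightarrow> 'a \<Rightarrow> nat" and \<gamma> b :: "nat \<Rightarrow> real"
  assumes indep: "indep_vars (\<lambda>_. count_space UNIV) X {1..}"
    and pos: "\<And>i \<omega>. 1 \<le> i \<Longrightarrow> \<omega> \<in> space M \<Longrightarrow> 1 \<le> X i \<omega>"
    and \<gamma>: "\<And>h d. 1 \<le> h \<Longrightarrow> h \<le> d \<Longrightarrow> \<bar>\<gamma> d\<bar> \<le> b h" and b: "summable b"
  shows "AE \<omega> in M. (\<lambda>n. walk_gap_sum \<gamma> X n \<omega> / real n
      - expectation (\<lambda>\<omega>. walk_gap_sum \<gamma> X n \<omega>) / real n) \<longlonglongrightarrow> 0"
proof -
  define I where "I h i = {i + 2..i + Suc h + 1}" for h i :: nat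
  define Z where "Z h i \<omega> = \<gamma> (\<Sum>j\<in>I h i. X j \<omega>)" for h i \<omega>
  define W where "W h i \<omega> = Z h i \<omega> - expectation (Z h i)" for h i \<omega>
  have X_meas: "X i \<in> measurable M (count_space UNIV)" if "1 \<le> i" for i
    using indep that by (auto simp: indep_vars_def)
  have Z_meas[measurable]: "Z h i \<in> borel_measurable M" for h i
  proof -
    have "(\<lambda>\<omega>. \<Sum>j\<in>I h i. X j \<omega>) \<in> measurable M (count_space UNIV)"
      by (intro measurable_sum_nat X_meas) (auto simp: I_def)
    then show ?thesis unfolding Z_def[abs_def] by (rule measurable_compose) simp
  qed
  have Z_bound: "\<bar>Z h i \<omega>\<bar> \<le> b (Suc h)" if "\<omega> \<in> space M" for h i \<omega>
  proof -
    have "(\<Sum>j\<in>I h i. 1) \<le> (\<Sum>j\<in>I h i. X j \<omega>)"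
      using pos that by (intro sum_mono) (auto simp: I_def)
    then show ?thesis unfolding Z_def by (intro \<gamma>) (auto simp: I_def)
  qed
  have Z_int: "integrable M (Z h i)" for h i
    by (rule integrable_const_bound[of _ "b (Suc h)"]) (use Z_bound in auto)
  have EZ_bound: "\<bar>expectation (Z h i)\<bar> \<le> b (Suc h)" for h i
  proof -
    have "\<bar>expectation (Z h i)\<bar> \<le> expectation (\<lambda>x. \<bar>Z h i x\<bar>)" by (rule integral_abs_bound)
    also have "\<dots> \<le> expectation (\<lambda>x. b (Suc h))"
      using Z_int Z_bound by (intro integral_mono) auto
    finally show ?thesis by (simp add: prob_space)
  qed
  have W_bound: "\<bar>W h i \<omega>\<bar> \<le> 2 * b (Suc h)" if "\<omega> \<in> space M" for h i \<omega>
    using Z_bound[OF that, of h i] EZ_bound[of h i] unfolding W_def by linarith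
  have [measurable]: "W h i \<in> borel_measurable M" for h i unfolding W_def[abs_def] by measurable
  have W_int: "integrable M (W h i)" for h i unfolding W_def[abs_def] using Z_int by simp
  have EW: "expectation (W h i) = 0" for h i
    unfolding W_def[abs_def] using Z_int by (simp add: prob_space)
  have uncorrelated: "expectation (\<lambda>x. W h i x * W h k x) = 0" if "i + Suc h \<le> k" for h i k
  proof -
    let ?f = "\<lambda>i u. \<gamma> (\<Sum>j\<in>I h i. u j) - expectation (Z h i)"
    have f: "?f i \<in> borel_measurable (Pi\<^sub>M (I h i) (\<lambda>_. count_space UNIV))" for i
    proof -
      have "(\<lambda>u. \<Sum>j\<in>I h i. u j :: nat) \<in> measurable (Pi\<^sub>M (I h i) (\<lambda>_. count_space UNIV)) (count_space UNIV)"
        by (intro measurable_sum_nat measurable_component_singleton)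
      then have "(\<lambda>u. \<gamma> (\<Sum>j\<in>I h i. u j)) \<in> borel_measurable (Pi\<^sub>M (I h i) (\<lambda>_. count_space UNIV))"
        by (rule measurable_compose) simp
      then show ?thesis by (intro borel_measurable_diff borel_measurable_const)
    qed
    have "indep_var (Pi\<^sub>M (I h i) (\<lambda>_. count_space UNIV)) (\<lambda>\<omega>. restrict (\<lambda>j. X j \<omega>) (I h i))
        (Pi\<^sub>M (I h k) (\<lambda>_. count_space UNIV)) (\<lambda>\<omega>. restrict (\<lambda>j. X j \<omega>) (I h k))"
      by (rule indep_var_restrict[OF indep]) (use that in \<open>auto simp: I_def\<close>)
    from indep_var_compose[OF this f f] have "indep_var borel (W h i) borel (W h k)"
      by (simp add: comp_def W_def[abs_def] Z_def)
    from indep_var_lebesgue_integral[OF this W_int W_int] show ?thesis by (simp add: EW)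
  qed
  have "AE \<omega> in M. \<forall>h. (\<lambda>n. (\<Sum>i<n. W h i \<omega>) / real n) \<longlonglongrightarrow> 0"
    unfolding AE_all_countable
    by (intro allI strong_law_finite_range[where B="2 * b (Suc _)" and h="Suc _"]) (auto intro: W_bound uncorrelated)
  with AE_space show ?thesis
  proof eventually_elim
    case (elim \<omega>)
    define a where "a h n = 2 * ((\<Sum>i<n - Suc h. W h i \<omega>) / real n)" for h n
    have eq: "walk_gap_sum \<gamma> X n \<omega> / real n - expectation (\<lambda>\<omega>. walk_gap_sum \<gamma> X n \<omega>) / real n = (\<Sum>h. a h n)" for n
    proof -
      have "expectation (\<lambda>\<omega>. walk_gap_sum \<gamma> X n \<omega>)
          = real n * \<gamma> 0 + 2 * (\<Sum>h<n. \<Sum>i<n - Suc h. expectation (Z h i))"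
        unfolding walk_gap_sum_def I_def[symmetric] Z_def[symmetric] using Z_int by (simp add: prob_space)
      then have "walk_gap_sum \<gamma> X n \<omega> / real n - expectation (\<lambda>\<omega>. walk_gap_sum \<gamma> X n \<omega>) / real n
          = (\<Sum>h<n. a h n)"
        unfolding walk_gap_sum_def I_def[symmetric] Z_def[symmetric] a_def W_def
        by (simp add: sum_subtractf diff_divide_distrib add_divide_distrib sum_divide_distrib sum_distrib_left right_diff_distrib)
      also have "\<dots> = (\<Sum>h. a h n)"
        by (rule suminf_finite[symmetric]) (auto simp: a_def)
      finally show ?thesis .
    qed
    have "(\<lambda>n. \<Sum>h. a h n) \<longlonglongrightarrow> (\<Sum>h. 0)"
    proof (rule tannerys_theorem[THEN conjunct2, THEN conjunct2])
      show "(\<lambda>n. a h n) \<longlonglongrightarrow> 0" for h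
      proof (rule Lim_null_comparison)
        have "(\<lambda>n. (\<Sum>i<n - Suc h. W h i \<omega>) / real (n - Suc h)) \<longlonglongrightarrow> 0"
          using filterlim_compose[OF elim(2)[rule_format, of h] filterlim_minus_const_nat_at_top] .
        then have "(\<lambda>n. 2 * \<bar>(\<Sum>i<n - Suc h. W h i \<omega>) / real (n - Suc h)\<bar>) \<longlonglongrightarrow> 2 * 0"
          by (intro tendsto_intros tendsto_rabs_zero)
        then show "(\<lambda>n. 2 * \<bar>(\<Sum>i<n - Suc h. W h i \<omega>) / real (n - Suc h)\<bar>) \<longlonglongrightarrow> 0" by simp
        show "\<forall>\<^sub>F n in sequentially. norm (a h n) \<le> 2 * \<bar>(\<Sum>i<n - Suc h. W h i \<omega>) / real (n - Suc h)\<bar>"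
          using eventually_gt_at_top[of "Suc h"]
        proof eventually_elim
          case (elim n)
          then show ?case unfolding a_def by (auto simp: abs_mult intro!: divide_left_mono)
        qed
      qed
      show "\<forall>\<^sub>F (h, n) in sequentially \<times>\<^sub>F sequentially. norm (a h n) \<le> 4 * b (Suc h)"
      proof (rule always_eventually, clarify)
        fix h n
        have "0 \<le> b (Suc h)" using \<gamma>[of "Suc h" "Suc h"] by simp
        have "\<bar>\<Sum>i<n - Suc h. W h i \<omega>\<bar> \<le> real (n - Suc h) * (2 * b (Suc h))"
          using sum_bounded_above[of "{..<n - Suc h}" "\<lambda>i. \<bar>W h i \<omega>\<bar>"] W_bound[OF elim(1)]
          by (intro order_trans[OF sum_abs]) auto
        also have "\<dots> \<le> real n * (2 * b (Suc h))"
          using \<open>0 \<le> b (Suc h)\<close> by (intro mult_right_mono) auto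
        finally have "\<bar>\<Sum>i<n - Suc h. W h i \<omega>\<bar> / real n \<le> 2 * b (Suc h)"
          using \<open>0 \<le> b (Suc h)\<close> by (cases "n = 0") (simp_all add: divide_le_eq mult.commute)
        then show "norm (a h n) \<le> 4 * b (Suc h)" by (simp add: a_def)
      qed
      show "summable (\<lambda>h. 4 * b (Suc h))" using b by (simp add: summable_Suc_iff)
    qed simp
    then show ?case by (simp add: eq)
  qed
qed

section \<open>Sampling a stationary sequence along a walk\<close>

lemma strictly_stationary_integral:
  fixes F :: "(nat \<Rightarrow> real) \<Rightarrow> real"
  assumes stat: "strictly_stationary M \<xi>" and J: "finite J" and F[measurable]: "F \<in> borel_measurable (Pi\<^sub>M J (\<lambda>_. borel))"
  shows "(\<integral>x. F (\<lambda>i\<in>J. \<xi> (i + h) x) \<partial>M) = (\<integral>x. F (\<lambda>i\<in>J. \<xi> i x) \<partial>M)"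
proof -
  have \<xi>[measurable]: "\<And>i. \<xi> i \<in> borel_measurable M"
    and eq: "distr M (\<Pi>\<^sub>M i\<in>J. borel) (\<lambda>x. \<lambda>i\<in>J. \<xi> (i + h) x) = distr M (\<Pi>\<^sub>M i\<in>J. borel) (\<lambda>x. \<lambda>i\<in>J. \<xi> i x)"
    using stat J by (auto simp: strictly_stationary_def)
  have m: "(\<lambda>x. \<lambda>i\<in>J. \<xi> (i + h) x) \<in> measurable M (\<Pi>\<^sub>M i\<in>J. borel)" for h
    by (rule measurable_restrict) simp
  show ?thesis
    using integral_distr[OF m[of h] F] integral_distr[OF m[of 0] F] eq by simp
qed

lemma strictly_stationary_ident:
  assumes stat: "strictly_stationary M \<xi>"
  shows "distr M borel (\<xi> i) = distr M borel (\<xi> 0)"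
proof -
  have \<xi>[measurable]: "\<And>i. \<xi> i \<in> borel_measurable M"
    and eq: "distr M (\<Pi>\<^sub>M i\<in>{0}. borel) (\<lambda>x. \<lambda>j\<in>{0}. \<xi> (j + i) x) = distr M (\<Pi>\<^sub>M i\<in>{0}. borel) (\<lambda>x. \<lambda>i\<in>{0}. \<xi> i x)"
    using stat by (auto simp: strictly_stationary_def)
  have m: "(\<lambda>x. \<lambda>j\<in>{0::nat}. \<xi> (j + i) x) \<in> measurable M (\<Pi>\<^sub>M i\<in>{0}. borel)" for i
    by (rule measurable_restrict) simp
  have proj: "(\<lambda>u. u 0) \<in> measurable (\<Pi>\<^sub>M i\<in>{0::nat}. borel :: real measure) borel"
    by (rule measurable_component_singleton) simp
  have "distr M borel (\<xi> i) = distr (distr M (\<Pi>\<^sub>M i\<in>{0}. borel) (\<lambda>x. \<lambda>j\<in>{0}. \<xi> (j + i) x)) borel (\<lambda>u. u 0)" for i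
    by (subst distr_distr[OF proj m]) (simp add: comp_def)
  from this[of i] this[of 0] eq show ?thesis by simp
qed

lemma strictly_stationary_covariance:
  fixes u :: "real \<Rightarrow> real"
  assumes stat: "strictly_stationary M \<xi>" and [measurable]: "u \<in> borel_measurable borel"
  shows "(\<integral>x. u (\<xi> i x) * u (\<xi> (i + d) x) \<partial>M) = (\<integral>x. u (\<xi> 0 x) * u (\<xi> d x) \<partial>M)"
  using strictly_stationary_integral[OF stat, of "{0, d}" "\<lambda>v. u (v 0) * u (v d)" i]
  by (simp add: add.commute)

lemma strict_mono_add_le:
  fixes s :: "nat \<Rightarrow> nat"
  assumes "strict_mono s"
  shows "s k + q \<le> s (k + q)"
proof (induction q)
  case (Suc q)
  have "s (k + q) < s (k + Suc q)" using assms by (simp add: strict_mono_def)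
  then show ?case using Suc by simp
qed simp

text \<open>A strictly increasing sampling does not shorten gaps, and the past of the sampled sequence up to time
\<open>k\<close> is contained in the past of \<open>\<xi>\<close> up to time \<open>s k\<close>. The vectors in \<open>theta2_seq\<close> range over
arbitrary increasing indices, so blocks of the sampled sequence are admissible there.\<close>

lemma weakly_dependent_subsequence:
  fixes \<xi> :: "nat \<Rightarrow> 'b \<Rightarrow> real" and s :: "nat \<Rightarrow> nat"
  assumes \<mu>: "prob_space \<mu>" and stat: "strictly_stationary \<mu> \<xi>"
    and sq: "\<And>i. integrable \<mu> (\<lambda>y. (\<xi> i y)\<^sup>2)" and s: "strict_mono s"
    and theta: "\<And>n. 1 \<le> n \<Longrightarrow> theta2_seq \<mu> \<xi> n \<le> ennreal (r n)"
    and r_nonneg: "\<And>n. 0 \<le> r n" and r_antimono: "\<And>m n. 1 \<le> m \<Longrightarrow> m \<le> n \<Longrightarrow> r n \<le> r m"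
    and r_small: "(\<lambda>n. real n powr (3/2) * r n) \<longlonglongrightarrow> 0"
  shows "weakly_dependent \<mu> (\<lambda>i. \<xi> (s i)) r"
proof -
  interpret prob_space \<mu> by fact
  have \<xi>[measurable]: "\<xi> i \<in> borel_measurable \<mu>" for i
    using stat by (simp add: strictly_stationary_def)
  show ?thesis
  proof unfold_locales
    show "distr \<mu> borel (\<xi> (s i)) = distr \<mu> borel (\<xi> (s 0))" for i
      using strictly_stationary_ident[OF stat] by metis
    fix \<Phi> :: "'b \<Rightarrow> real" and k q l :: nat and \<phi> h :: "real \<Rightarrow> real" and L :: real
    assume \<Phi>: "\<Phi> \<in> borel_measurable (past_algebra \<mu> (\<lambda>i. \<xi> (s i)) k)" and \<Phi>2: "integrable \<mu> (\<lambda>x. (\<Phi> x)\<^sup>2)"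
      and q: "1 \<le> q" and \<phi>: "1-lipschitz_on UNIV \<phi>" and h: "L-lipschitz_on UNIV h"
    let ?T = "\<lambda>x. \<Sum>i\<in>{k + q..<k + q + l}. \<phi> (\<xi> (s i) x)"
    have [measurable]: "\<phi> \<in> borel_measurable borel" "h \<in> borel_measurable borel"
      using lipschitz_on_borel_measurable \<phi> h by blast+
    have L: "0 \<le> L" by (rule lipschitz_on_nonneg[OF h])
    have \<Phi>': "\<Phi> \<in> borel_measurable (past_algebra \<mu> \<xi> (s k))"
    proof (rule measurable_from_subalg[OF _ \<Phi>])
      have "(\<Union>j\<in>{..k}. {\<xi> (s j) -` A \<inter> space \<mu> |A. A \<in> sets borel})
          \<subseteq> (\<Union>j\<in>{..s k}. {\<xi> j -` A \<inter> space \<mu> |A. A \<in> sets borel})"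
        using strict_mono_mono[OF s] by (auto simp: mono_def)
      then show "subalgebra (past_algebra \<mu> \<xi> (s k)) (past_algebra \<mu> (\<lambda>i. \<xi> (s i)) k)"
        unfolding subalgebra_def past_algebra_def
        by (auto simp: space_measure_of_conv sets_measure_of_conv intro: subsetD[OF sigma_sets_subseteq] split: if_splits)
    qed
    show "\<bar>\<integral>x. \<Phi> x * (h (?T x) - (\<integral>z. h (?T z) \<partial>\<mu>)) \<partial>\<mu>\<bar> \<le> L * L2_norm \<mu> \<Phi> * (real l * r q)"
    proof (cases "l = 0 \<or> L = 0")
      case True
      then have "h (?T x) = h 0" for x
        using lipschitz_on_real_bound(1)[OF h, of "?T x" 0] by auto
      then show ?thesis using True by (auto simp: prob_space)
    next
      case False
      then have l: "1 \<le> l" and L0: "0 < L" using L by auto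
      define j where "j i = s (k + q + i)" for i
      \<comment> \<open>Normalised to Lipschitz constant 1 for the distance \<open>d1\<close>.\<close>
      define f where "f u = h (\<Sum>i<l. \<phi> (u i)) / L" for u :: "nat \<Rightarrow> real"
      define W where "W = (\<lambda>x. f (\<lambda>i\<in>{..<l}. \<xi> (j i) x))"
      have W: "h (?T x) = L * W x" for x
      proof -
        have "?T x = (\<Sum>i<l. \<phi> (\<xi> (j i) x))"
          using sum.atLeastLessThan_shift_0[of "\<lambda>i. \<phi> (\<xi> (s i) x)" "k + q" "k + q + l"]
          by (simp add: j_def atLeast0LessThan)
        then show ?thesis using L0 by (simp add: W_def f_def)
      qed
      have f: "f \<in> Lip1 l"
        unfolding Lip1_def
      proof (intro CollectI ballI)
        fix u v :: "nat \<Rightarrow> real"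
        have "\<bar>f u - f v\<bar> = \<bar>h (\<Sum>i<l. \<phi> (u i)) - h (\<Sum>i<l. \<phi> (v i))\<bar> / L"
          using L0 by (simp add: f_def diff_divide_distrib[symmetric])
        also have "\<dots> \<le> \<bar>(\<Sum>i<l. \<phi> (u i)) - (\<Sum>i<l. \<phi> (v i))\<bar>"
          using lipschitz_on_real_bound(1)[OF h] L0 by (simp add: divide_le_eq mult.commute)
        also have "\<dots> \<le> d1 l u v"
          unfolding d1_def sum_subtractf[symmetric]
          using lipschitz_on_real_bound(1)[OF \<phi>] by (intro order_trans[OF sum_abs] sum_mono) simp
        finally show "\<bar>f u - f v\<bar> \<le> d1 l u v" .
      qed
      have N: "L2_norm \<mu> (\<lambda>x. real_cond_exp \<mu> (past_algebra \<mu> \<xi> (s k)) W x - expectation W) \<le> real l * r q"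
        unfolding W_def
      proof (rule L2_norm_cond_exp_le_theta2_seq[OF theta[OF q] r_nonneg l _ _ f])
        show "strict_mono_on {..<l} j" "s k + q \<le> j 0"
          using s strict_mono_add_le[OF s, of k q] by (auto simp: j_def strict_mono_def intro!: strict_mono_onI)
      qed
      have W': "W = (\<lambda>x. h (?T x) / L)" using W L0 by (simp add: fun_eq_iff)
      have W_meas: "W \<in> borel_measurable \<mu>" unfolding W' by measurable
      have "integrable \<mu> (\<lambda>x. (h (?T x))\<^sup>2)"
        by (intro lipschitz_square_integrable[OF h] L2_sum_integrable lipschitz_square_integrable[OF \<phi>] sq) auto
      then have W2: "integrable \<mu> (\<lambda>x. (W x)\<^sup>2)" by (simp add: W' power_divide)
      have "(\<integral>x. \<Phi> x * (h (?T x) - (\<integral>z. h (?T z) \<partial>\<mu>)) \<partial>\<mu>) = L * (\<integral>x. \<Phi> x * (W x - expectation W) \<partial>\<mu>)"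
        unfolding W by (simp add: right_diff_distrib[symmetric] mult.left_commute)
      then have "\<bar>\<integral>x. \<Phi> x * (h (?T x) - (\<integral>z. h (?T z) \<partial>\<mu>)) \<partial>\<mu>\<bar> = L * \<bar>\<integral>x. \<Phi> x * (W x - expectation W) \<partial>\<mu>\<bar>"
        using L by (simp add: abs_mult)
      also have "\<dots> \<le> L * (L2_norm \<mu> \<Phi> * (real l * r q))"
        by (intro mult_left_mono L order_trans[OF integral_mult_centred_le[OF subalgebra_past_algebra \<Phi>' \<Phi>2 W_meas W2]] N)
          (auto simp: L2_norm_nonneg)
      finally show ?thesis by (simp add: mult.assoc)
    qed
  qed (use sq r_nonneg r_antimono r_small in auto)
qed

text \<open>At \<open>x = 2 powr (i * \<epsilon>)\<close> the monotone function equals \<open>2 powr (3 * i * \<epsilon> / 2) * g x\<close>, which is at most the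
\<open>i\<close>-th term of the series because \<open>\<epsilon> < 1\<close>. One small term controls all larger arguments.\<close>

lemma antimono_tendsto_zero_of_geometric_sum:
  fixes g :: "real \<Rightarrow> real"
  assumes nonneg: "\<And>x. 0 < x \<Longrightarrow> 0 \<le> g x" and anti: "antimono_on {0<..} (\<lambda>x. x powr (3/2) * g x)"
    and \<epsilon>: "\<epsilon> \<in> {0<..<1}" and sum: "summable (\<lambda>i::nat. 2 powr (3 * real i / 2) * g (2 powr (real i * \<epsilon>)))"
  shows "(\<lambda>n. real n powr (3/2) * g (real n)) \<longlonglongrightarrow> 0"
proof (rule LIMSEQ_I)
  fix \<delta> :: real assume "0 < \<delta>"
  then have "\<forall>\<^sub>F i in sequentially. 2 powr (3 * real i / 2) * g (2 powr (real i * \<epsilon>)) < \<delta>"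
    by (intro order_tendstoD(2)[OF summable_LIMSEQ_zero[OF sum]])
  then obtain i where i: "2 powr (3 * real i / 2) * g (2 powr (real i * \<epsilon>)) < \<delta>"
    by (auto simp: eventually_sequentially)
  define x where "x = 2 powr (real i * \<epsilon>)"
  have x: "0 < x" by (simp add: x_def)
  have "x powr (3/2) \<le> 2 powr (3 * real i / 2)"
    unfolding x_def powr_powr using \<epsilon> by (intro powr_mono) (auto simp: mult_left_le_one_le mult.commute[of _ \<epsilon>])
  then have "x powr (3/2) * g x \<le> 2 powr (3 * real i / 2) * g x"
    using nonneg[OF x] by (rule mult_right_mono)
  with i have G: "x powr (3/2) * g x < \<delta>" by (simp add: x_def)
  have "norm (real n powr (3/2) * g (real n) - 0) < \<delta>" if "nat \<lceil>x\<rceil> \<le> n" for n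
  proof -
    have n: "x \<le> real n" using that by linarith
    then have "real n powr (3/2) * g (real n) \<le> x powr (3/2) * g x"
      using x by (intro monotone_onD[OF anti]) auto
    then show ?thesis using G nonneg[of "real n"] n x by simp
  qed
  then show "\<exists>N. \<forall>n\<ge>N. norm (real n powr (3/2) * g (real n) - 0) < \<delta>" by blast
qed

lemma walk_gap:
  assumes "i \<le> k"
  shows "walk X k \<omega> = walk X i \<omega> + (\<Sum>j\<in>{i + 1..k}. X j \<omega>)"
  using assms unfolding walk_def by (induction k rule: dec_induct) auto

lemma stationary_variance_along_subsequence:
  fixes u :: "real \<Rightarrow> real" and s :: "nat \<Rightarrow> nat"
  assumes \<mu>: "prob_space \<mu>" and stat: "strictly_stationary \<mu> \<xi>" and u[measurable]: "u \<in> borel_measurable borel"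
    and sq: "\<And>i. integrable \<mu> (\<lambda>y. (u (\<xi> i y))\<^sup>2)" and s: "mono s"
  defines "\<gamma> \<equiv> \<lambda>d. \<integral>y. u (\<xi> 0 y) * u (\<xi> d y) \<partial>\<mu>"
  shows "(\<integral>y. (\<Sum>i<n. u (\<xi> (s i) y))\<^sup>2 \<partial>\<mu>)
    = real n * \<gamma> 0 + 2 * (\<Sum>h<n. \<Sum>i<n - Suc h. \<gamma> (s (i + Suc h) - s i))"
proof -
  interpret prob_space \<mu> by fact
  have [measurable]: "\<xi> i \<in> borel_measurable \<mu>" for i
    using stat by (simp add: strictly_stationary_def)
  define c where "c i k = (\<integral>y. u (\<xi> (s i) y) * u (\<xi> (s k) y) \<partial>\<mu>)" for i k
  have cov: "c i (i + d) = \<gamma> (s (i + d) - s i)" for i d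
    using strictly_stationary_covariance[OF stat u, of "s i" "s (i + d) - s i"] monoD[OF s, of i "i + d"]
    by (simp add: c_def \<gamma>_def)
  have int: "integrable \<mu> (\<lambda>y. u (\<xi> i y) * u (\<xi> k y))" for i k
    by (rule L2_mult_integrable) (auto intro: sq)
  have "(\<integral>y. (\<Sum>i<n. u (\<xi> (s i) y))\<^sup>2 \<partial>\<mu>) = (\<Sum>i<n. \<Sum>k<n. c i k)"
    unfolding c_def using int by (simp add: power2_eq_square sum_product)
  also have "\<dots> = (\<Sum>i<n. c i i) + 2 * (\<Sum>h<n. \<Sum>i<n - Suc h. c i (i + Suc h))"
    by (rule sum_symmetric_eq_diagonal_sums) (simp add: c_def mult.commute)
  finally have eq: "(\<integral>y. (\<Sum>i<n. u (\<xi> (s i) y))\<^sup>2 \<partial>\<mu>) = \<dots>" .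
  have "c i i = \<gamma> 0" for i using cov[of i 0] by simp
  then show ?thesis unfolding eq cov by simp
qed

text \<open>When every section is centred, the variance of the conditional mean is zero and the variance on the
product space is the average of the variances of the sections.\<close>

lemma (in pair_prob_space) integral_square_of_centred_sections:
  fixes D :: "'a \<times> 'b \<Rightarrow> real"
  assumes D[measurable]: "D \<in> borel_measurable (M1 \<Otimes>\<^sub>M M2)"
    and sq: "\<And>\<omega>. \<omega> \<in> space M1 \<Longrightarrow> integrable M2 (\<lambda>y. (D (\<omega>, y))\<^sup>2)"
    and bound: "\<And>\<omega>. \<omega> \<in> space M1 \<Longrightarrow> (\<integral>y. (D (\<omega>, y))\<^sup>2 \<partial>M2) \<le> B"
    and centred: "\<And>\<omega>. \<omega> \<in> space M1 \<Longrightarrow> (\<integral>y. D (\<omega>, y) \<partial>M2) = 0"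
  shows "integrable (M1 \<Otimes>\<^sub>M M2) D" "P.expectation D = 0"
    "P.expectation (\<lambda>z. (D z)\<^sup>2) = (\<integral>\<omega>. (\<integral>y. (D (\<omega>, y))\<^sup>2 \<partial>M2) \<partial>M1)"
proof -
  have D2: "integrable (M1 \<Otimes>\<^sub>M M2) (\<lambda>z. (D z)\<^sup>2)"
  proof (rule Fubini_integrable)
    show "AE \<omega> in M1. integrable M2 (\<lambda>y. (D (\<omega>, y))\<^sup>2)" using sq by auto
    show "integrable M1 (\<lambda>\<omega>. \<integral>y. norm ((D (\<omega>, y))\<^sup>2) \<partial>M2)"
    proof (rule M1.integrable_const_bound[of _ B])
      show "AE \<omega> in M1. norm (\<integral>y. norm ((D (\<omega>, y))\<^sup>2) \<partial>M2) \<le> B" using bound by auto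
    qed measurable
  qed measurable
  show D1: "integrable (M1 \<Otimes>\<^sub>M M2) D"
    by (rule P.square_integrable_imp_integrable[OF D D2])
  have "P.expectation D = (\<integral>\<omega>. (\<integral>y. D (\<omega>, y) \<partial>M2) \<partial>M1)"
    by (rule integral_fst'[OF D1, symmetric])
  also have "\<dots> = (\<integral>\<omega>. 0 \<partial>M1)"
    by (rule Bochner_Integration.integral_cong) (simp_all add: centred)
  finally show "P.expectation D = 0" by simp
  show "P.expectation (\<lambda>z. (D z)\<^sup>2) = (\<integral>\<omega>. (\<integral>y. (D (\<omega>, y))\<^sup>2 \<partial>M2) \<partial>M1)"
    by (rule integral_fst'[OF D2, symmetric])
qed

theorem corollary6p1:
  fixes P :: "'a measure" and \<mu> :: "'b measure"
    and X :: "nat \<Rightarrow> 'a \<Rightarrow> nat" and \<xi> :: "nat \<Rightarrow> 'b \<Rightarrow> real"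
    and g :: "real \<Rightarrow> real" and a :: real
  assumes P: "prob_space P"
    and X_indep: "prob_space.indep_vars P (\<lambda>_. count_space UNIV) X {1..}"
    and X_ident: "\<And>i. i \<ge> 1 \<Longrightarrow> distr P (count_space UNIV) (X i) = distr P (count_space UNIV) (X 1)"
    and X_pos: "\<And>i \<omega>. i \<ge> 1 \<Longrightarrow> \<omega> \<in> space P \<Longrightarrow> X i \<omega> \<ge> 1"
    and \<mu>: "prob_space \<mu>"
    and \<xi>_stat: "strictly_stationary \<mu> \<xi>"
    and \<xi>_sq: "\<And>i. integrable \<mu> (\<lambda>y. (\<xi> i y)\<^sup>2)"
    and g_nonneg: "\<And>x. x > 0 \<Longrightarrow> g x \<ge> 0"
    and theta_g: "\<And>n. n \<ge> 1 \<Longrightarrow> theta2_seq \<mu> \<xi> n \<le> ennreal (g (real n))"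
    and g_mono: "antimono_on {0<..} (\<lambda>x. x powr (3/2) * g x)"
    and g_sum: "\<exists>\<epsilon>\<in>{0<..<1}. summable (\<lambda>i::nat. 2 powr (3 * real i / 2) * g (2 powr (real i * \<epsilon>)))"
    and a_lim: "(\<lambda>n. real n * prob_space.variance (P \<Otimes>\<^sub>M \<mu>) (\<lambda>(\<omega>, y). m_hat X \<xi> n \<omega> y)) \<longlonglongrightarrow> a"
    and a_pos: "a > 0"
  shows "AE \<omega> in P. weak_conv_m
           (\<lambda>n. distr \<mu> borel (\<lambda>y. sqrt (real n) * (m_hat X \<xi> n \<omega> y - (\<integral>z. \<xi> 0 z \<partial>\<mu>))))
           (density lborel (normal_density 0 (sqrt a)))"
proof -
  interpret P: prob_space P by fact
  interpret U: prob_space \<mu> by fact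
  interpret PU: pair_prob_space P \<mu> ..
  \<comment> \<open>The absolute value matters only at \<open>n = 0\<close>, where \<open>g\<close> may be negative.\<close>
  define r where "r n = \<bar>g (real n)\<bar>" for n
  have r_g: "r n = g (real n)" if "1 \<le> n" for n using g_nonneg[of "real n"] that by (simp add: r_def)
  have r_nonneg: "0 \<le> r n" for n by (simp add: r_def)
  have theta: "theta2_seq \<mu> \<xi> n \<le> ennreal (r n)" if "1 \<le> n" for n
    using theta_g[OF that] by (simp add: r_g[OF that])
  have r_antimono: "r n \<le> r k" if "1 \<le> k" "k \<le> n" for k n
  proof -
    have "real n powr (3/2) * g n \<le> real k powr (3/2) * g k"
      using that by (intro monotone_onD[OF g_mono]) auto
    also have "\<dots> \<le> real n powr (3/2) * g k"
      using that g_nonneg[of k] by (intro mult_right_mono powr_mono2) auto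
    finally show ?thesis using that by (simp add: r_g)
  qed
  have r_small: "(\<lambda>n. real n powr (3/2) * r n) \<longlonglongrightarrow> 0"
  proof -
    have "(\<lambda>n. real n powr (3/2) * g (real n)) \<longlonglongrightarrow> 0"
      using antimono_tendsto_zero_of_geometric_sum[OF g_nonneg g_mono] g_sum by blast
    moreover have "(\<lambda>n. real n powr (3/2) * r n) = (\<lambda>n. real n powr (3/2) * g (real n))"
    proof
      show "real n powr (3/2) * r n = real n powr (3/2) * g (real n)" for n
        by (cases "1 \<le> n") (simp_all add: r_g)
    qed
    ultimately show ?thesis by (simp only:)
  qed
  note subsequence = weakly_dependent_subsequence[OF \<mu> \<xi>_stat \<xi>_sq _ theta r_nonneg r_antimono r_small]
  define m where "m = (\<integral>z. \<xi> 0 z \<partial>\<mu>)"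
  have \<xi>_meas[measurable]: "\<xi> i \<in> borel_measurable \<mu>" for i
    using \<xi>_stat by (simp add: strictly_stationary_def)
  interpret Y: weakly_dependent \<mu> \<xi> r
    using subsequence[of "\<lambda>i. i"] by (simp add: strict_mono_def)
  interpret Y: weakly_dependent_transform \<mu> \<xi> r "\<lambda>y. y - m"
    by (rule Y.transform_centred) (simp_all add: m_def lipschitz_on_def)
  define \<gamma> where "\<gamma> d = (\<integral>y. (\<xi> 0 y - m) * (\<xi> d y - m) \<partial>\<mu>)" for d
  \<comment> \<open>The sampled times are numbered from 0, whereas \<open>m_hat\<close> starts with \<open>S\<^sub>1\<close>.\<close>
  define s where "s \<omega> i = walk X (Suc i) \<omega>" for \<omega> i
  have s: "strict_mono (s \<omega>)" if "\<omega> \<in> space P" for \<omega>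
    using X_pos[OF _ that] by (intro strict_mono_Suc_iff[THEN iffD2]) (simp add: s_def walk_def Suc_le_eq)
  have V_eq: "(\<integral>y. (\<Sum>i<n. \<xi> (s \<omega> i) y - m)\<^sup>2 \<partial>\<mu>) = walk_gap_sum \<gamma> X n \<omega>" if "\<omega> \<in> space P" for n \<omega>
  proof -
    have "s \<omega> (i + Suc h) - s \<omega> i = (\<Sum>j\<in>{i + 2..i + Suc h + 1}. X j \<omega>)" for i h
      unfolding s_def using walk_gap[of "Suc i" "Suc (i + Suc h)" X \<omega>] by simp
    then show ?thesis
      using stationary_variance_along_subsequence[OF \<mu> \<xi>_stat, of "\<lambda>y. y - m" "s \<omega>" n]
        Y.\<phi>_Y_square_integrable strict_mono_mono[OF s[OF that]]
      by (simp only: walk_gap_sum_def \<gamma>_def Y.\<phi>_measurable)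
  qed
  have V_le: "(\<integral>y. (\<Sum>i<n. \<xi> (s \<omega> i) y - m)\<^sup>2 \<partial>\<mu>) \<le> Y.C * real n" if "\<omega> \<in> space P" for n \<omega>
  proof -
    have inj: "inj_on (s \<omega>) {..<n}" by (rule strict_mono_imp_inj_on[OF s[OF that]])
    show ?thesis using Y.variance_S_le[of "s \<omega> ` {..<n}"]
      by (simp add: Y.S_def sum.reindex[OF inj] card_image[OF inj])
  qed
  \<comment> \<open>The quenched variance approaches its mean, and the mean converges by hypothesis.\<close>
  have concentration: "AE \<omega> in P. (\<lambda>n. walk_gap_sum \<gamma> X n \<omega> / real n
      - P.expectation (\<lambda>\<omega>. walk_gap_sum \<gamma> X n \<omega>) / real n) \<longlonglongrightarrow> 0"
  proof (rule P.walk_gap_sum_concentration[OF X_indep X_pos])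
    fix h d :: nat assume hd: "1 \<le> h" "h \<le> d"
    have "\<bar>\<gamma> d\<bar> \<le> Y.\<sigma> * r d" using Y.covariance_le[of 0 d] hd by (simp add: \<gamma>_def)
    also have "\<dots> \<le> Y.\<sigma> * r h" by (intro mult_left_mono r_antimono hd Y.\<sigma>_nonneg)
    finally show "\<bar>\<gamma> d\<bar> \<le> Y.\<sigma> * r h" .
  qed (simp_all add: summable_mult Y.r_summable)
  have mean_variance: "(\<lambda>n. P.expectation (\<lambda>\<omega>. walk_gap_sum \<gamma> X n \<omega>) / real n) \<longlonglongrightarrow> a"
  proof -
    have "real n * PU.P.variance (\<lambda>(\<omega>, y). m_hat X \<xi> n \<omega> y) = P.expectation (\<lambda>\<omega>. walk_gap_sum \<gamma> X n \<omega>) / real n" for n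
    proof (cases "n = 0")
      case False
      define D where "D z = (\<Sum>i<n. \<xi> (s (fst z) i) (snd z) - m)" for z
      have s_meas: "(\<lambda>\<omega>. s \<omega> i) \<in> measurable P (count_space UNIV)" for i
        unfolding s_def walk_def using X_indep
        by (intro measurable_sum_nat) (auto simp: P.indep_vars_def)
      have D_meas: "D \<in> borel_measurable (P \<Otimes>\<^sub>M \<mu>)"
      proof -
        have "(\<lambda>z. \<xi> (s (fst z) i) (snd z)) \<in> borel_measurable (P \<Otimes>\<^sub>M \<mu>)" for i
          by (rule measurable_compose_countable[where f="\<lambda>k z. \<xi> k (snd z)"])
            (auto intro: measurable_compose[OF measurable_fst s_meas])
        then show ?thesis unfolding D_def[abs_def]
          by (intro borel_measurable_sum borel_measurable_diff borel_measurable_const)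
      qed
      have D: "PU.P.expectation D = 0" "integrable (P \<Otimes>\<^sub>M \<mu>) D"
        "PU.P.expectation (\<lambda>z. (D z)\<^sup>2) = (\<integral>\<omega>. (\<integral>y. (D (\<omega>, y))\<^sup>2 \<partial>\<mu>) \<partial>P)"
      proof -
        have sq: "integrable \<mu> (\<lambda>y. (D (\<omega>, y))\<^sup>2)" if "\<omega> \<in> space P" for \<omega>
          unfolding D_def by (intro U.L2_sum_integrable) (simp_all add: Y.\<phi>_Y_square_integrable)
        have bd: "(\<integral>y. (D (\<omega>, y))\<^sup>2 \<partial>\<mu>) \<le> Y.C * real n" if "\<omega> \<in> space P" for \<omega>
          unfolding D_def fst_conv snd_conv by (rule V_le[OF that])
        have "integrable \<mu> (\<xi> i)" for i by (rule Y.Y_integrable)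
        then have cent: "(\<integral>y. D (\<omega>, y) \<partial>\<mu>) = 0" if "\<omega> \<in> space P" for \<omega>
          unfolding D_def fst_conv snd_conv by (simp add: Y.\<phi>_Y_mean_zero[simplified])
        show "PU.P.expectation D = 0" "integrable (P \<Otimes>\<^sub>M \<mu>) D"
          "PU.P.expectation (\<lambda>z. (D z)\<^sup>2) = (\<integral>\<omega>. (\<integral>y. (D (\<omega>, y))\<^sup>2 \<partial>\<mu>) \<partial>P)"
          using PU.integral_square_of_centred_sections[OF D_meas sq bd cent] by auto
      qed
      have f: "(\<lambda>(\<omega>, y). m_hat X \<xi> n \<omega> y) = (\<lambda>z. D z / real n + m)"
        using False
        by (auto simp: fun_eq_iff m_hat_def D_def s_def sum.atLeast1_atMost_eq sum_subtractf diff_divide_distrib)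
      have "PU.P.expectation (\<lambda>z. D z / real n + m) = m"
        using D(1,2) by (simp add: PU.P.prob_space)
      then have "PU.P.variance (\<lambda>(\<omega>, y). m_hat X \<xi> n \<omega> y) = PU.P.expectation (\<lambda>z. (D z)\<^sup>2) / (real n)\<^sup>2"
        unfolding f by (simp add: power_divide)
      also have "PU.P.expectation (\<lambda>z. (D z)\<^sup>2) = P.expectation (\<lambda>\<omega>. walk_gap_sum \<gamma> X n \<omega>)"
        unfolding D(3) by (rule Bochner_Integration.integral_cong) (simp_all add: D_def V_eq)
      finally show ?thesis using False by (simp add: power2_eq_square)
    qed simp
    then show ?thesis using a_lim by simp
  qed
  from concentration AE_space[of P] show ?thesis
  proof eventually_elim
    case (elim \<omega>)
    interpret Z: weakly_dependent \<mu> "\<lambda>i. \<xi> (s \<omega> i)" r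
      by (rule subsequence[OF s[OF elim(2)]])
    have mean: "U.expectation (\<xi> (s \<omega> 0)) = m"
      using Y.integral_Y_eq[of "\<lambda>x. x" "s \<omega> 0"] by (simp add: m_def)
    have "(\<lambda>n. (walk_gap_sum \<gamma> X n \<omega> / real n - P.expectation (\<lambda>\<omega>. walk_gap_sum \<gamma> X n \<omega>) / real n)
        + P.expectation (\<lambda>\<omega>. walk_gap_sum \<gamma> X n \<omega>) / real n) \<longlonglongrightarrow> 0 + a"
      by (intro tendsto_add elim(1) mean_variance)
    then have "(\<lambda>n. (\<integral>y. (\<Sum>i<n. \<xi> (s \<omega> i) y - m)\<^sup>2 \<partial>\<mu>) / real n) \<longlonglongrightarrow> a"
      by (simp add: V_eq[OF elim(2)])
    from Z.clt[unfolded mean, OF this a_pos] show ?case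
      by (simp add: m_hat_def s_def sum.atLeast1_atMost_eq m_def)
  qed
qed

end
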